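(* Let $\alpha\in(0,1)$, $r>0$, and let $X\subset\mathbb{R}^d$ be a set of $n$ points contained in the Euclidean ball $B(0,r)$ with $0\in X$. Then there exists a mapping $f:\mathbb{R}^d\to\mathbb{R}^m$ with $m=O(\alpha^{-2}\log n)$ such that for every $p\in X$ and every $q\in\mathbb{R}^d$, $\left|\,\|p-q\|_2-\|f(p)-f(q)\|_2\,\right|\leq \alpha\cdot r$.
   Context: Such a mapping is called an $\alpha$-additive terminal embedding of $X$. *)

theory Defs
  imports "HOL-Analysis.Analysis"
begin

text \<open>
  A point of \<open>\<real>\<^sup>d\<close> is a sequence vanishing from index \<open>d\<close> on, i.e. an element of
  \<^term>\<open>topspace (Euclidean_space d)\<close>. The dimension is thus a natural number that can be
  quantified in a formula; with type-indexed dimensions the implied constant of a bound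
  \<open>m = O(\<dots>)\<close> could depend on \<open>d\<close>.
\<close>

definition Rn :: "nat \<Rightarrow> (nat \<Rightarrow> real) set"
  where "Rn d = topspace (Euclidean_space d)"

definition norm2 :: "nat \<Rightarrow> (nat \<Rightarrow> real) \<Rightarrow> real"
  where "norm2 d x = L2_set x {..<d}"

definition dist2 :: "nat \<Rightarrow> (nat \<Rightarrow> real) \<Rightarrow> (nat \<Rightarrow> real) \<Rightarrow> real"
  where "dist2 d x y = norm2 d (\<lambda>i. x i - y i)"

end

theory Submission
  imports Defs
begin

text \<open>
  Let \<open>T\<close> be the set of normalised differences of points of \<open>X\<close> and let \<open>\<Pi>\<close> be a scaled random
  sign matrix with \<open>m = O(\<epsilon>\<^sup>-\<^sup>2 log n)\<close> rows. With positive probability \<open>\<Pi>\<close> preserves the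
  norms of all \<open>t \<in> T\<close> up to a factor \<open>1 \<plusminus> \<epsilon>\<close> and, for every \<open>k\<close>, does not shrink the squared norm of
  any sum of \<open>k\<close> elements of \<open>T\<close> by more than a factor \<open>1 - \<epsilon> \<surd>k\<close>: there are at most
  \<open>n\<^sup>2\<^sup>k\<close> such sums and each one fails with probability \<open>exp (- c m \<epsilon>\<^sup>2 k)\<close>. Applying Maurey's
  empirical method to \<open>w \<in> conv T\<close> with about \<open>1 / |w|\<^sup>2\<close> samples turns this into
  \<open>|\<Pi> w| \<ge> |w| - O(\<epsilon>)\<close> on all of \<open>conv T\<close>, with no loss in \<open>\<epsilon>\<close>.

  By convex duality every \<open>v\<close> then has a \<open>u\<close> with \<open>|u| \<le> |v|\<close> and
  \<open>\<langle>u, \<Pi> t\<rangle> = \<langle>v, t\<rangle> \<plusminus> O(\<epsilon>) |v|\<close> for all \<open>t \<in> T\<close>. A point \<open>q\<close> with nearest point \<open>p\<^sub>0 \<in> X\<close> is mapped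
  to \<open>(\<Pi> p\<^sub>0 + u, sqrt (|v|\<^sup>2 - |u|\<^sup>2))\<close> where \<open>v = q - p\<^sub>0\<close>. For \<open>p \<in> X\<close> at distance \<open>a\<close> from \<open>q\<close>
  the squared distance changes by \<open>O(\<epsilon>) |p - p\<^sub>0| (|p - p\<^sub>0| + |v|)\<close>, which is \<open>O(\<epsilon> r a)\<close> since
  \<open>|v| \<le> a\<close>, so the distance changes by \<open>O(\<epsilon> r)\<close>.
\<close>

section \<open>Exponential moments of random signs\<close>

definition ip :: "nat \<Rightarrow> (nat \<Rightarrow> real) \<Rightarrow> (nat \<Rightarrow> real) \<Rightarrow> real"
  where "ip d x y = (\<Sum>i<d. x i * y i)"

text \<open>Extensional functions make this a finite set, so that probabilities can be expressed by
  counting and expectations by finite sums, without a measure.\<close>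

definition sgn_vecs :: "nat \<Rightarrow> (nat \<Rightarrow> real) set"
  where "sgn_vecs d = PiE {..<d} (\<lambda>_. {-1, 1})"

lemma finite_sgn_vecs: "finite (sgn_vecs d)"
  unfolding sgn_vecs_def by (intro finite_PiE) auto

lemma card_sgn_vecs: "card (sgn_vecs d) = 2 ^ d"
  unfolding sgn_vecs_def by (subst card_PiE) (auto simp: card_insert_if numeral_2_eq_2)

lemma sum_sgn_vecs_0:
  fixes F :: "(nat \<Rightarrow> real) \<Rightarrow> real"
  shows "(\<Sum>s\<in>sgn_vecs 0. F s) = F (\<lambda>_. undefined)"
  unfolding sgn_vecs_def by simp

text \<open>Conditioning on the last sign; every moment bound below is an induction on
  \<open>d\<close> by this rule.\<close>

lemma sum_sgn_vecs_Suc: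
  fixes F :: "(nat \<Rightarrow> real) \<Rightarrow> real"
  shows "(\<Sum>s\<in>sgn_vecs (Suc d). F s) = (\<Sum>s\<in>sgn_vecs d. F (s(d := -1)) + F (s(d := 1)))"
proof -
  have inj: "inj_on (\<lambda>(y, g). g(d := y)) ({-1, 1::real} \<times> sgn_vecs d)"
  proof (rule inj_onI, clarify)
    fix y y' :: real and g g'
    assume g: "g \<in> sgn_vecs d" "g' \<in> sgn_vecs d" and eq: "g(d := y) = g'(d := y')"
    have "g d = g' d" using g by (auto simp: sgn_vecs_def PiE_def extensional_def)
    then show "y = y' \<and> g = g'" using eq by (metis fun_upd_same fun_upd_triv fun_upd_upd)
  qed
  have "sgn_vecs (Suc d) = (\<lambda>(y, g). g(d := y)) ` ({-1, 1} \<times> sgn_vecs d)"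
    unfolding sgn_vecs_def lessThan_Suc by (rule PiE_insert_eq)
  then have "(\<Sum>s\<in>sgn_vecs (Suc d). F s) = (\<Sum>(y, g)\<in>{-1, 1} \<times> sgn_vecs d. F (g(d := y)))"
    using sum.reindex[OF inj, of F] by (simp add: case_prod_unfold)
  also have "\<dots> = (\<Sum>y\<in>{-1, 1}. \<Sum>g\<in>sgn_vecs d. F (g(d := y)))"
    by (rule sum.cartesian_product[symmetric])
  finally show ?thesis by (simp add: sum.distrib)
qed

section \<open>Low moments of random sign sums and the exponential moment for the lower tail\<close>

lemma ip_upd: "ip (Suc d) (s(d := y)) w = ip d s w + y * w d"
  unfolding ip_def by simp

lemma ip_Suc: "ip (Suc d) x y = ip d x y + x d * y d"
  unfolding ip_def by simp

lemma ip_0: "ip 0 x y = 0"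
  unfolding ip_def by simp

lemma ip_self_nonneg: "0 \<le> ip d x x"
  unfolding ip_def by (intro sum_nonneg) auto

text \<open>The offset \<open>a\<close> absorbs the last summand, which becomes a shift by
  \<open>w d\<close> in either direction; this lets the induction close.\<close>

lemma sum_sgn_sq:
  "(\<Sum>s\<in>sgn_vecs d. (a + ip d s w)\<^sup>2) = 2 ^ d * (a\<^sup>2 + ip d w w)"
proof (induction d arbitrary: a)
  case (Suc d)
  have "(\<Sum>s\<in>sgn_vecs (Suc d). (a + ip (Suc d) s w)\<^sup>2)
      = (\<Sum>s\<in>sgn_vecs d. ((a - w d) + ip d s w)\<^sup>2) + (\<Sum>s\<in>sgn_vecs d. ((a + w d) + ip d s w)\<^sup>2)"
    by (simp add: sum_sgn_vecs_Suc ip_upd sum.distrib algebra_simps)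
  also have "\<dots> = 2 ^ Suc d * (a\<^sup>2 + ip (Suc d) w w)"
    unfolding Suc.IH ip_Suc by (simp add: power2_eq_square algebra_simps)
  finally show ?case .
qed (simp add: sum_sgn_vecs_0 ip_0 card_sgn_vecs)

text \<open>The bracket is the fourth moment of \<open>a + G\<close> for a centred Gaussian
  \<open>G\<close> of variance \<open>ip d w w\<close>. Signs have a smaller fourth moment, and each
  induction step discards \<open>2 * (w d) ^ 4\<close>.\<close>

lemma sum_sgn_pow4:
  "(\<Sum>s\<in>sgn_vecs d. (a + ip d s w) ^ 4) \<le> 2 ^ d * (a ^ 4 + 6 * a\<^sup>2 * ip d w w + 3 * (ip d w w)\<^sup>2)"
proof (induction d arbitrary: a)
  case (Suc d)
  let ?W = "ip d w w"
  have "(\<Sum>s\<in>sgn_vecs (Suc d). (a + ip (Suc d) s w) ^ 4)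
      = (\<Sum>s\<in>sgn_vecs d. ((a - w d) + ip d s w) ^ 4) + (\<Sum>s\<in>sgn_vecs d. ((a + w d) + ip d s w) ^ 4)"
    by (simp add: sum_sgn_vecs_Suc ip_upd sum.distrib algebra_simps)
  also have "\<dots> \<le> 2 ^ d * ((a - w d) ^ 4 + 6 * (a - w d)\<^sup>2 * ?W + 3 * ?W\<^sup>2)
      + 2 ^ d * ((a + w d) ^ 4 + 6 * (a + w d)\<^sup>2 * ?W + 3 * ?W\<^sup>2)"
    by (intro add_mono Suc.IH)
  also have "\<dots> = 2 ^ Suc d * (a ^ 4 + 6 * a\<^sup>2 * (?W + w d * w d) + 3 * (?W + w d * w d)\<^sup>2
      - 2 * (w d) ^ 4)"
    by (simp add: power2_eq_square power4_eq_xxxx) algebra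
  also have "\<dots> \<le> 2 ^ Suc d * (a ^ 4 + 6 * a\<^sup>2 * (?W + w d * w d) + 3 * (?W + w d * w d)\<^sup>2)"
    by (intro mult_left_mono) auto
  finally show ?case by (simp add: ip_Suc)
qed (simp add: sum_sgn_vecs_0 ip_0 card_sgn_vecs)

lemma exp_minus_le_quadratic:
  fixes x :: real
  assumes "0 \<le> x"
  shows "exp (- x) \<le> 1 - x + x\<^sup>2 / 2"
proof -
  have "((\<lambda>x. 1 - x + x\<^sup>2 / 2 - exp (- x)) has_real_derivative (- 1 + y + exp (- y))) (at y)" for y :: real
    by (auto intro!: derivative_eq_intros)
  moreover have "0 \<le> - 1 + y + exp (- y)" for y :: real
    using exp_ge_add_one_self[of "- y"] by simp
  ultimately have "(\<lambda>x. 1 - x + x\<^sup>2 / 2 - exp (- x)) 0 \<le> (\<lambda>x. 1 - x + x\<^sup>2 / 2 - exp (- x)) x"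
    using assms by (intro DERIV_nonneg_imp_nondecreasing[where f="\<lambda>x. 1 - x + x\<^sup>2 / 2 - exp (- x)"]) blast+
  then show ?thesis by simp
qed

text \<open>For a negative exponent the second-order Taylor polynomial is an upper bound, so the
  second and fourth moments suffice.\<close>

lemma sum_sgn_exp_neg:
  assumes "0 \<le> h" "ip d w w = 1"
  shows "(\<Sum>s\<in>sgn_vecs d. exp (- h * (ip d s w)\<^sup>2)) \<le> 2 ^ d * exp (- h + 3 / 2 * h\<^sup>2)"
proof -
  have "(\<Sum>s\<in>sgn_vecs d. exp (- h * (ip d s w)\<^sup>2))
      \<le> (\<Sum>s\<in>sgn_vecs d. 1 - h * (ip d s w)\<^sup>2 + h\<^sup>2 / 2 * (ip d s w) ^ 4)"
  proof (rule sum_mono)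
    fix s
    show "exp (- h * (ip d s w)\<^sup>2) \<le> 1 - h * (ip d s w)\<^sup>2 + h\<^sup>2 / 2 * (ip d s w) ^ 4"
      using exp_minus_le_quadratic[of "h * (ip d s w)\<^sup>2"] assms
      by (simp add: power_mult_distrib)
  qed
  also have "\<dots> = 2 ^ d - h * (\<Sum>s\<in>sgn_vecs d. (0 + ip d s w)\<^sup>2)
      + h\<^sup>2 / 2 * (\<Sum>s\<in>sgn_vecs d. (0 + ip d s w) ^ 4)"
    by (simp add: sum.distrib sum_subtractf sum_distrib_left card_sgn_vecs)
  also have "\<dots> \<le> 2 ^ d - h * (2 ^ d) + h\<^sup>2 / 2 * (2 ^ d * 3)"
    using sum_sgn_pow4[where d=d and a=0 and w=w] sum_sgn_sq[where d=d and a=0 and w=w] assms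
    by (intro add_mono diff_mono mult_left_mono) auto
  also have "\<dots> = 2 ^ d * (1 + (- h + 3 / 2 * h\<^sup>2))"
    by (simp add: algebra_simps)
  also have "\<dots> \<le> 2 ^ d * exp (- h + 3 / 2 * h\<^sup>2)"
    by (intro mult_left_mono exp_ge_add_one_self) auto
  finally show ?thesis .
qed

text \<open>On the nonnegative axis \<open>x\<^sup>2 / 2 - ln (cosh x)\<close> vanishes at 0 and has
  derivative \<open>x - tanh x\<close>, which is nonnegative; symmetry gives the rest.\<close>

lemma cosh_le_exp_half_sq:
  fixes x :: real
  shows "exp x + exp (- x) \<le> 2 * exp (x\<^sup>2 / 2)"
proof -
  have tanh_le: "tanh y \<le> y" if "0 \<le> y" for y :: real
  proof -
    have "((\<lambda>x. x - tanh x) has_real_derivative (tanh y)\<^sup>2) (at y)" for y :: real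
      by (auto intro!: derivative_eq_intros simp: cosh_real_pos less_imp_neq[OF cosh_real_pos, symmetric])
    then have "0 - tanh 0 \<le> y - tanh y"
      using that by (intro DERIV_nonneg_imp_nondecreasing[where f="\<lambda>x. x - tanh x"]) force+
    then show ?thesis by simp
  qed
  have nonneg: "cosh y \<le> exp (y\<^sup>2 / 2)" if "0 \<le> y" for y :: real
  proof -
    have "((\<lambda>x. x\<^sup>2 / 2 - ln (cosh x)) has_real_derivative z - tanh z) (at z)" for z :: real
      by (auto intro!: derivative_eq_intros simp: cosh_real_pos tanh_def)
    then have "0\<^sup>2 / 2 - ln (cosh 0) \<le> y\<^sup>2 / 2 - ln (cosh y)"
      using that tanh_le
      by (intro DERIV_nonneg_imp_nondecreasing[where f="\<lambda>x. x\<^sup>2 / 2 - ln (cosh x)"]) force+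
    then have "ln (cosh y) \<le> y\<^sup>2 / 2" by simp
    then show ?thesis by (metis cosh_real_pos exp_le_cancel_iff exp_ln)
  qed
  have "cosh x \<le> exp (x\<^sup>2 / 2)"
    using nonneg[of x] nonneg[of "- x"] by (cases "0 \<le> x") auto
  then show ?thesis by (simp add: cosh_field_def)
qed

text \<open>
  The bound is the exact value for a Gaussian vector in place of the signs; unlike the bound for
  \<open>a = 0\<close> alone, it is reproduced by adding one coordinate at a time.
\<close>

lemma sum_sgn_exp_pos:
  assumes "0 \<le> h" "2 * h * ip d w w < 1"
  shows "(\<Sum>s\<in>sgn_vecs d. exp (h * (a + ip d s w)\<^sup>2))
    \<le> 2 ^ d * (exp (h * a\<^sup>2 / (1 - 2 * h * ip d w w)) / sqrt (1 - 2 * h * ip d w w))"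
  using assms
proof (induction d arbitrary: a)
  case (Suc d)
  let ?W = "ip d w w" and ?x = "w d"
  let ?D = "1 - 2 * h * ?W"
  have hx: "0 \<le> 2 * h * (?x * ?x)" using Suc.prems by simp
  have D: "?D > 0" "2 * h * ?W < 1" "?D - 2 * h * ?x\<^sup>2 > 0"
    using Suc.prems hx unfolding ip_Suc distrib_left power2_eq_square by linarith+
  \<comment> \<open>The exponent coefficient left by the induction hypothesis for the first
    \<open>d\<close> coordinates; the last sign is averaged with \<open>k\<close> in place of
    \<open>h\<close>.\<close>
  define k where "k = h / ?D"
  have k: "0 \<le> k" using D Suc.prems by (simp add: k_def)
  have kx: "2 * k * ?x\<^sup>2 < 1"
    using D by (simp add: k_def field_simps)
  have eq: "1 - 2 * h * ip (Suc d) w w = ?D * (1 - 2 * k * ?x\<^sup>2)"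
    using D by (simp add: k_def ip_Suc field_simps power2_eq_square)
  have "exp (k * (a - ?x)\<^sup>2) + exp (k * (a + ?x)\<^sup>2)
      = exp (k * a\<^sup>2 + k * ?x\<^sup>2) * (exp (2 * k * a * ?x) + exp (- (2 * k * a * ?x)))"
    by (simp add: distrib_left flip: exp_add) (simp add: algebra_simps power2_eq_square)
  also have "\<dots> \<le> exp (k * a\<^sup>2 + k * ?x\<^sup>2) * (2 * exp ((2 * k * a * ?x)\<^sup>2 / 2))"
    by (intro mult_left_mono cosh_le_exp_half_sq) auto
  also have "\<dots> = 2 * (exp (k * ?x\<^sup>2) * exp (k * a\<^sup>2 * (1 + 2 * k * ?x\<^sup>2)))"
    by (simp add: algebra_simps power2_eq_square flip: exp_add)
  \<comment> \<open>With \<open>y = 2 * k * (w d)\<^sup>2\<close>, the first factor uses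
    \<open>1 - y \<le> exp (- y)\<close> and the second uses
    \<open>1 + y \<le> 1 / (1 - y)\<close>.\<close>
  also have "\<dots> \<le> 2 * (1 / sqrt (1 - 2 * k * ?x\<^sup>2) * exp (k * a\<^sup>2 / (1 - 2 * k * ?x\<^sup>2)))"
  proof (intro mult_left_mono mult_mono)
    let ?y = "2 * k * ?x\<^sup>2"
    have y: "0 \<le> ?y" "?y < 1" using k kx by auto
    have "1 - ?y \<le> exp (- ?y)" using exp_ge_add_one_self[of "- ?y"] by simp
    also have "\<dots> = (exp (- (k * ?x\<^sup>2)))\<^sup>2" by (simp add: power2_eq_square flip: exp_add)
    finally have "sqrt (1 - ?y) \<le> exp (- (k * ?x\<^sup>2))"
      by (rule real_le_lsqrt[rotated 1]) auto
    then show "exp (k * ?x\<^sup>2) \<le> 1 / sqrt (1 - ?y)"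
      using y by (simp add: exp_minus field_simps)
    have "(1 + ?y) * (1 - ?y) = 1 - ?y\<^sup>2" by (simp add: algebra_simps power2_eq_square)
    then have "(1 + ?y) * (1 - ?y) \<le> 1" using zero_le_power2[of ?y] by linarith
    then have "1 + ?y \<le> 1 / (1 - ?y)" using y by (simp add: pos_le_divide_eq)
    then have "k * a\<^sup>2 * (1 + ?y) \<le> k * a\<^sup>2 * (1 / (1 - ?y))"
      using k by (intro mult_left_mono) auto
    then show "exp (k * a\<^sup>2 * (1 + ?y)) \<le> exp (k * a\<^sup>2 / (1 - ?y))" by simp
  qed (use kx in auto)
  finally have step: "exp (k * (a - ?x)\<^sup>2) + exp (k * (a + ?x)\<^sup>2)
    \<le> 2 * (1 / sqrt (1 - 2 * k * ?x\<^sup>2) * exp (k * a\<^sup>2 / (1 - 2 * k * ?x\<^sup>2)))" .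
  have "(\<Sum>s\<in>sgn_vecs (Suc d). exp (h * (a + ip (Suc d) s w)\<^sup>2))
      = (\<Sum>s\<in>sgn_vecs d. exp (h * ((a - ?x) + ip d s w)\<^sup>2)) + (\<Sum>s\<in>sgn_vecs d. exp (h * ((a + ?x) + ip d s w)\<^sup>2))"
    by (simp add: sum_sgn_vecs_Suc ip_upd sum.distrib algebra_simps)
  also have "\<dots> \<le> 2 ^ d * (exp (h * (a - ?x)\<^sup>2 / ?D) / sqrt ?D) + 2 ^ d * (exp (h * (a + ?x)\<^sup>2 / ?D) / sqrt ?D)"
    using Suc.prems D by (intro add_mono Suc.IH) auto
  also have "\<dots> = 2 ^ d / sqrt ?D * (exp (k * (a - ?x)\<^sup>2) + exp (k * (a + ?x)\<^sup>2))"
    by (simp add: k_def distrib_left)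
  also have "\<dots> \<le> 2 ^ d / sqrt ?D * (2 * (1 / sqrt (1 - 2 * k * ?x\<^sup>2) * exp (k * a\<^sup>2 / (1 - 2 * k * ?x\<^sup>2))))"
    using D by (intro mult_left_mono step) auto
  also have "\<dots> = 2 ^ Suc d * (exp (h * a\<^sup>2 / (1 - 2 * h * ip (Suc d) w w)) / sqrt (1 - 2 * h * ip (Suc d) w w))"
    unfolding eq by (simp add: real_sqrt_mult k_def)
  finally show ?case .
qed (simp add: sum_sgn_vecs_0 ip_0 card_sgn_vecs)

section \<open>Random sign matrices\<close>

definition sgn_mats :: "nat \<Rightarrow> nat \<Rightarrow> (nat \<Rightarrow> nat \<Rightarrow> real) set"
  where "sgn_mats m d = PiE {..<m} (\<lambda>_. sgn_vecs d)"

text \<open>The squared norm of the unscaled image of \<open>w\<close>; its mean over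
  \<open>sgn_mats m d\<close> is \<open>m * ip d w w\<close>.\<close>

definition energy :: "nat \<Rightarrow> nat \<Rightarrow> (nat \<Rightarrow> nat \<Rightarrow> real) \<Rightarrow> (nat \<Rightarrow> real) \<Rightarrow> real"
  where "energy m d M w = (\<Sum>j<m. (ip d (M j) w)\<^sup>2)"

text \<open>Lists instead of sets, because sampling in Maurey's method may repeat an
  element.\<close>

definition lsum :: "(nat \<Rightarrow> real) list \<Rightarrow> nat \<Rightarrow> real"
  where "lsum ts = (\<lambda>i. \<Sum>t\<leftarrow>ts. t i)"

lemma finite_sgn_mats: "finite (sgn_mats m d)"
  unfolding sgn_mats_def by (intro finite_PiE finite_sgn_vecs) auto

lemma card_sgn_mats: "card (sgn_mats m d) = (2 ^ d) ^ m"
  unfolding sgn_mats_def by (subst card_PiE) (auto simp: card_sgn_vecs)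

text \<open>Chernoff's method: Markov's inequality for the exponential of the sum, which factors
  over the independent rows.\<close>

lemma card_sgn_mats_exp_le:
  assumes "(\<Sum>s\<in>sgn_vecs d. exp (\<phi> s)) \<le> 2 ^ d * exp b"
  shows "real (card {M \<in> sgn_mats m d. real m * c \<le> (\<Sum>j<m. \<phi> (M j))})
    \<le> real (card (sgn_mats m d)) * exp (real m * (b - c))"
proof -
  let ?B = "{M \<in> sgn_mats m d. real m * c \<le> (\<Sum>j<m. \<phi> (M j))}"
  have "real (card ?B) * exp (real m * c) = (\<Sum>M\<in>?B. exp (real m * c))" by simp
  also have "\<dots> \<le> (\<Sum>M\<in>?B. exp (\<Sum>j<m. \<phi> (M j)))" by (intro sum_mono) auto
  also have "\<dots> \<le> (\<Sum>M\<in>sgn_mats m d. exp (\<Sum>j<m. \<phi> (M j)))"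
    by (intro sum_mono2 finite_sgn_mats) auto
  also have "\<dots> = (\<Prod>j<m. \<Sum>s\<in>sgn_vecs d. exp (\<phi> s))"
    unfolding sgn_mats_def by (subst prod_sum_PiE) (auto simp: finite_sgn_vecs exp_sum)
  also have "\<dots> \<le> (2 ^ d * exp b) ^ m"
    using assms by (simp add: power_mono sum_nonneg)
  also have "\<dots> = real (card (sgn_mats m d)) * exp (real m * b)"
    by (simp add: card_sgn_mats power_mult_distrib exp_of_nat_mult)
  finally show ?thesis
    by (simp add: right_diff_distrib exp_diff pos_le_divide_eq)
qed

section \<open>Tail bounds for a fixed vector\<close>

lemma ip_scale_right: "ip d x (\<lambda>i. c * y i) = c * ip d x y"
  unfolding ip_def by (simp add: sum_distrib_left algebra_simps)

lemma ip_commute: "ip d x y = ip d y x"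
  unfolding ip_def by (simp add: mult.commute)

lemma energy_scale: "energy m d M (\<lambda>i. c * w i) = c\<^sup>2 * energy m d M w"
  unfolding energy_def by (simp add: ip_scale_right power_mult_distrib sum_distrib_left)

lemma energy_nonneg: "0 \<le> energy m d M w"
  unfolding energy_def by (intro sum_nonneg) auto

text \<open>Chernoff bound for the lower tail, after scaling \<open>w\<close> to unit norm. Large
  deviations are included since \<open>exists_sgn_mat\<close> takes \<delta> to be \<epsilon> times
  the root of a list length.\<close>

lemma card_energy_less:
  assumes "0 \<le> \<delta>"
  shows "real (card {M \<in> sgn_mats m d. energy m d M w < real m * (1 - \<delta>) * ip d w w})
    \<le> real (card (sgn_mats m d)) * exp (- (real m * \<delta>\<^sup>2 / 6))"
proof (cases "ip d w w = 0")
  case True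
  then have "{M \<in> sgn_mats m d. energy m d M w < real m * (1 - \<delta>) * ip d w w} = {}"
    using energy_nonneg by (auto simp: not_less)
  then show ?thesis by (simp only:) simp
next
  case False
  then have W: "ip d w w > 0" using ip_self_nonneg[of d w] by simp
  define c where "c = 1 / sqrt (ip d w w)"
  define u where "u = (\<lambda>i. c * w i)"
  have c2: "c\<^sup>2 * ip d w w = 1" using W by (simp add: c_def power_divide)
  have u: "ip d u u = 1"
    using c2 unfolding u_def by (simp add: ip_scale_right ip_commute[of d "\<lambda>i. c * w i"] power2_eq_square)
  have eu: "energy m d M u = c\<^sup>2 * energy m d M w" for M
    unfolding u_def by (rule energy_scale)
  \<comment> \<open>The minimiser of \<open>3 / 2 * h\<^sup>2 - h * \<delta>\<close>.\<close>
  define h where "h = \<delta> / 3"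
  have "real (card {M \<in> sgn_mats m d. energy m d M w < real m * (1 - \<delta>) * ip d w w})
      \<le> real (card {M \<in> sgn_mats m d. real m * (- h * (1 - \<delta>)) \<le> (\<Sum>j<m. - h * (ip d (M j) u)\<^sup>2)})"
  proof (intro of_nat_mono card_mono)
    show "{M \<in> sgn_mats m d. energy m d M w < real m * (1 - \<delta>) * ip d w w}
      \<subseteq> {M \<in> sgn_mats m d. real m * (- h * (1 - \<delta>)) \<le> (\<Sum>j<m. - h * (ip d (M j) u)\<^sup>2)}"
    proof clarify
      fix M assume "energy m d M w < real m * (1 - \<delta>) * ip d w w"
      then have "c\<^sup>2 * energy m d M w \<le> c\<^sup>2 * (real m * (1 - \<delta>) * ip d w w)"
        by (intro mult_left_mono) auto
      also have "\<dots> = real m * (1 - \<delta>)" using c2 by (simp add: algebra_simps)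
      finally have "energy m d M u \<le> real m * (1 - \<delta>)" by (simp add: eu)
      then have "h * energy m d M u \<le> h * (real m * (1 - \<delta>))"
        using assms by (intro mult_left_mono) (auto simp: h_def)
      moreover have "(\<Sum>j<m. - h * (ip d (M j) u)\<^sup>2) = - h * energy m d M u"
        unfolding energy_def by (simp add: sum_distrib_left sum_negf)
      ultimately show "real m * (- h * (1 - \<delta>)) \<le> (\<Sum>j<m. - h * (ip d (M j) u)\<^sup>2)"
        by (simp add: algebra_simps)
    qed
  qed (simp add: finite_sgn_mats)
  also have "\<dots> \<le> real (card (sgn_mats m d)) * exp (real m * ((- h + 3 / 2 * h\<^sup>2) - (- h * (1 - \<delta>))))"
    using assms by (intro card_sgn_mats_exp_le sum_sgn_exp_neg u) (auto simp: h_def)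
  also have "real m * ((- h + 3 / 2 * h\<^sup>2) - (- h * (1 - \<delta>))) = - (real m * \<delta>\<^sup>2 / 6)"
    by (simp add: h_def field_simps power2_eq_square)
  finally show ?thesis .
qed

text \<open>Chernoff bound for the upper tail, where fourth moments no longer suffice and
  \<open>sum_sgn_exp_pos\<close> enters.\<close>

lemma card_energy_greater:
  assumes "0 \<le> \<epsilon>" "\<epsilon> \<le> 1" "ip d u u = 1"
  shows "real (card {M \<in> sgn_mats m d. real m * (1 + \<epsilon>) < energy m d M u})
    \<le> real (card (sgn_mats m d)) * exp (- (real m * \<epsilon>\<^sup>2 / 16))"
proof -
  \<comment> \<open>The minimiser of \<open>4 * h\<^sup>2 - h * \<epsilon>\<close>. The term
    \<open>4 * h\<^sup>2\<close> comes from \<open>ln (1 - y) \<ge> - y - 2 * y\<^sup>2\<close> at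
    \<open>y = 2 * h\<close>.\<close>
  define h where "h = \<epsilon> / 8"
  have h: "0 \<le> h" "2 * h \<le> 1 / 2" using assms by (auto simp: h_def)
  have "- (2 * h) - 2 * (2 * h)\<^sup>2 \<le> ln (1 - 2 * h)"
    using h ln_one_minus_pos_lower_bound[of "2 * h"] by simp
  then have "exp (- (2 * h) - 2 * (2 * h)\<^sup>2) \<le> 1 - 2 * h"
    using h by (subst (asm) ln_ge_iff) auto
  then have "sqrt (exp (- (2 * h) - 2 * (2 * h)\<^sup>2)) \<le> sqrt (1 - 2 * h)"
    by (rule real_sqrt_le_mono)
  moreover have "exp (- (2 * h) - 2 * (2 * h)\<^sup>2) = (exp (- h - 4 * h\<^sup>2))\<^sup>2"
    by (simp add: power2_eq_square algebra_simps flip: exp_add)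
  ultimately have "exp (- h - 4 * h\<^sup>2) \<le> sqrt (1 - 2 * h)"
    by (simp only: real_sqrt_abs abs_exp_cancel)
  then have "exp (- (h + 4 * h\<^sup>2)) \<le> sqrt (1 - 2 * h)"
    by simp
  then have "1 / sqrt (1 - 2 * h) \<le> exp (h + 4 * h\<^sup>2)"
    using h unfolding exp_minus by (simp add: field_simps)
  then have "2 ^ d * (1 / sqrt (1 - 2 * h)) \<le> 2 ^ d * exp (h + 4 * h\<^sup>2)"
    by (intro mult_left_mono) auto
  with sum_sgn_exp_pos[of h d u 0] have
    *: "(\<Sum>s\<in>sgn_vecs d. exp (h * (ip d s u)\<^sup>2)) \<le> 2 ^ d * exp (h + 4 * h\<^sup>2)"
    using h assms(3) by simp
  have "real (card {M \<in> sgn_mats m d. real m * (1 + \<epsilon>) < energy m d M u})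
      \<le> real (card {M \<in> sgn_mats m d. real m * (h * (1 + \<epsilon>)) \<le> (\<Sum>j<m. h * (ip d (M j) u)\<^sup>2)})"
  proof (intro of_nat_mono card_mono)
    show "{M \<in> sgn_mats m d. real m * (1 + \<epsilon>) < energy m d M u}
      \<subseteq> {M \<in> sgn_mats m d. real m * (h * (1 + \<epsilon>)) \<le> (\<Sum>j<m. h * (ip d (M j) u)\<^sup>2)}"
    proof clarify
      fix M assume "real m * (1 + \<epsilon>) < energy m d M u"
      then have "h * (real m * (1 + \<epsilon>)) \<le> h * energy m d M u"
        using h by (intro mult_left_mono) auto
      then show "real m * (h * (1 + \<epsilon>)) \<le> (\<Sum>j<m. h * (ip d (M j) u)\<^sup>2)"
        unfolding energy_def by (simp add: sum_distrib_left algebra_simps)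
    qed
  qed (simp add: finite_sgn_mats)
  also have "\<dots> \<le> real (card (sgn_mats m d)) * exp (real m * ((h + 4 * h\<^sup>2) - h * (1 + \<epsilon>)))"
    using * by (rule card_sgn_mats_exp_le)
  also have "real m * ((h + 4 * h\<^sup>2) - h * (1 + \<epsilon>)) = - (real m * \<epsilon>\<^sup>2 / 16)"
    by (simp add: h_def field_simps power2_eq_square)
  finally show ?thesis .
qed

text \<open>Union bound. Lists of length \<open>k\<close> contribute at most \<open>q ^ k\<close>
  with \<open>q \<le> 1 / 4\<close>, because the tolerated error grows like the root of
  \<open>k\<close> and its tail bound therefore pays for the number of lists. The total failure
  probability is at most \<open>1 / 4 + 1 / 3\<close>, whatever the cutoff \<open>K\<close>.\<close>

lemma exists_sgn_mat:
  assumes T: "finite T" "\<And>t. t \<in> T \<Longrightarrow> ip d t t = 1"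
    and \<epsilon>: "0 \<le> \<epsilon>" "\<epsilon> \<le> 1"
    and m: "real (card T) * exp (- (real m * \<epsilon>\<^sup>2 / 16)) \<le> 1 / 4"
  shows "\<exists>M. (\<forall>t\<in>T. energy m d M t \<le> real m * (1 + \<epsilon>)) \<and>
    (\<forall>ts. set ts \<subseteq> T \<and> length ts \<le> K \<longrightarrow>
       real m * (1 - \<epsilon> * sqrt (length ts)) * ip d (lsum ts) (lsum ts) \<le> energy m d M (lsum ts))"
proof -
  define q where "q = real (card T) * exp (- (real m * \<epsilon>\<^sup>2 / 16))"
  have q: "0 \<le> q" "q \<le> 1 / 4" using m by (auto simp: q_def)
  define N where "N = real (card (sgn_mats m d))"
  have N: "N > 0" by (simp add: N_def card_sgn_mats)
  define L where "L k = {ts. set ts \<subseteq> T \<and> length ts = k}" for k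
  define A where "A t = {M \<in> sgn_mats m d. real m * (1 + \<epsilon>) < energy m d M t}" for t
  define B where "B ts = {M \<in> sgn_mats m d.
    energy m d M (lsum ts) < real m * (1 - \<epsilon> * sqrt (length ts)) * ip d (lsum ts) (lsum ts)}" for ts
  have finL: "finite (L k)" for k unfolding L_def by (rule finite_lists_length_eq[OF T(1)])
  have cA: "real (card (A t)) \<le> N * exp (- (real m * \<epsilon>\<^sup>2 / 16))" if "t \<in> T" for t
    unfolding A_def N_def using \<epsilon> T(2)[OF that] by (rule card_energy_greater)
  have "real (card (\<Union>t\<in>T. A t)) \<le> (\<Sum>t\<in>T. real (card (A t)))"
    using card_UN_le[OF T(1), of A] by (simp flip: of_nat_sum)
  also have "\<dots> \<le> (\<Sum>t\<in>T. N * exp (- (real m * \<epsilon>\<^sup>2 / 16)))" by (intro sum_mono cA)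
  also have "\<dots> = N * q" by (simp add: q_def)
  finally have 1: "real (card (\<Union>t\<in>T. A t)) \<le> N * q" .
  have cB: "real (card (B ts)) \<le> N * exp (- (real m * \<epsilon>\<^sup>2 / 16)) ^ k" if "ts \<in> L k" for ts k
  proof -
    have "real (card (B ts)) \<le> N * exp (- (real m * (\<epsilon> * sqrt (length ts))\<^sup>2 / 6))"
      unfolding B_def N_def by (rule card_energy_less) (use \<epsilon> in auto)
    \<comment> \<open>The exponent constant 6 is weakened to 16 so that both tails are measured by
      the same \<open>q\<close>.\<close>
    also have "\<dots> \<le> N * exp (real k * (- (real m * \<epsilon>\<^sup>2 / 16)))"
      using N that by (auto simp: L_def power_mult_distrib field_simps)
    finally show ?thesis by (simp only: exp_of_nat_mult)
  qed
  have 2: "real (card (\<Union>ts\<in>L k. B ts)) \<le> N * q ^ k" for k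
  proof -
    have "real (card (\<Union>ts\<in>L k. B ts)) \<le> (\<Sum>ts\<in>L k. real (card (B ts)))"
      using card_UN_le[OF finL, of B k] by (simp flip: of_nat_sum)
    also have "\<dots> \<le> (\<Sum>ts\<in>L k. N * exp (- (real m * \<epsilon>\<^sup>2 / 16)) ^ k)" by (intro sum_mono cB)
    also have "\<dots> = N * q ^ k"
      unfolding L_def by (simp add: q_def card_lists_length_eq[OF T(1)] power_mult_distrib)
    finally show ?thesis .
  qed
  have "real (card (\<Union>k\<in>{1..K}. \<Union>ts\<in>L k. B ts)) \<le> (\<Sum>k\<in>{1..K}. real (card (\<Union>ts\<in>L k. B ts)))"
    using card_UN_le[of "{1..K}" "\<lambda>k. \<Union>ts\<in>L k. B ts"] by (simp flip: of_nat_sum)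
  also have "\<dots> \<le> (\<Sum>k\<in>{1..K}. N * q ^ k)" by (intro sum_mono 2)
  also have "\<dots> \<le> (\<Sum>k\<in>{1..K}. N * (1 / 4) ^ k)"
    using q N by (intro sum_mono mult_left_mono power_mono) auto
  also have "\<dots> = N * (\<Sum>k\<in>{1..K}. (1 / 4) ^ k)" by (simp add: sum_distrib_left)
  also have "(\<Sum>k\<in>{1..K}. (1 / 4 :: real) ^ k) = 1 / 3 - 1 / 3 * (1 / 4) ^ K"
    by (induction K) simp_all
  also have "N * (1 / 3 - 1 / 3 * (1 / 4) ^ K) \<le> N * (1 / 3)"
    using N by (intro mult_left_mono) auto
  finally have 3: "real (card (\<Union>k\<in>{1..K}. \<Union>ts\<in>L k. B ts)) \<le> N * (1 / 3)" .
  let ?U = "(\<Union>t\<in>T. A t) \<union> (\<Union>k\<in>{1..K}. \<Union>ts\<in>L k. B ts)"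
  have "real (card ?U) \<le> real (card (\<Union>t\<in>T. A t)) + real (card (\<Union>k\<in>{1..K}. \<Union>ts\<in>L k. B ts))"
    using card_Un_le[of "\<Union>t\<in>T. A t" "\<Union>k\<in>{1..K}. \<Union>ts\<in>L k. B ts"] by linarith
  also have "\<dots> \<le> N * q + N * (1 / 3)" using 1 3 by simp
  also have "\<dots> \<le> N * (1 / 4) + N * (1 / 3)" using q N by simp
  also have "\<dots> < N" using N by simp
  finally have "card ?U < card (sgn_mats m d)" by (simp add: N_def)
  moreover have "finite ?U" using T(1) finL by (auto simp: A_def B_def finite_sgn_mats)
  ultimately have "\<not> sgn_mats m d \<subseteq> ?U" using card_mono leD by blast
  then obtain M where M: "M \<in> sgn_mats m d" "M \<notin> ?U" by blast
  show ?thesis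
  proof (intro exI[of _ M] conjI ballI allI impI)
    fix t assume "t \<in> T"
    then show "energy m d M t \<le> real m * (1 + \<epsilon>)" using M by (auto simp: A_def not_less)
  next
    fix ts assume ts: "set ts \<subseteq> T \<and> length ts \<le> K"
    show "real m * (1 - \<epsilon> * sqrt (length ts)) * ip d (lsum ts) (lsum ts) \<le> energy m d M (lsum ts)"
    proof (cases "ts = []")
      case True
      then show ?thesis by (simp add: lsum_def ip_def energy_nonneg)
    next
      case False
      then have "length ts \<in> {1..K}" "ts \<in> L (length ts)" using ts by (auto simp: L_def Suc_le_eq)
      then have "M \<notin> B ts" using M by blast
      then show ?thesis using M by (auto simp: B_def not_less)
    qed
  qed
qed

section \<open>Convex combinations of unit vectors\<close>

text \<open>The family \<open>x\<close> is separate from the index set so that the same weights can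
  be applied to \<open>T\<close> and to its image under a linear map.\<close>

definition wsum :: "'a set \<Rightarrow> ('a \<Rightarrow> real) \<Rightarrow> ('a \<Rightarrow> nat \<Rightarrow> real) \<Rightarrow> nat \<Rightarrow> real"
  where "wsum T l x = (\<lambda>i. \<Sum>t\<in>T. l t * x t i)"

definition weights :: "'a set \<Rightarrow> ('a \<Rightarrow> real) set"
  where "weights T = {l. (\<forall>t\<in>T. 0 \<le> l t) \<and> sum l T = 1}"

lemma ip_add_right: "ip d x (\<lambda>i. y i + z i) = ip d x y + ip d x z"
  unfolding ip_def by (simp add: sum.distrib algebra_simps)

lemma ip_diff_right: "ip d x (\<lambda>i. y i - z i) = ip d x y - ip d x z"
  unfolding ip_def by (simp add: sum_subtractf algebra_simps)

lemma ip_add_left: "ip d (\<lambda>i. y i + z i) x = ip d y x + ip d z x"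
  unfolding ip_def by (simp add: sum.distrib algebra_simps)

lemma ip_diff_left: "ip d (\<lambda>i. y i - z i) x = ip d y x - ip d z x"
  unfolding ip_def by (simp add: sum_subtractf algebra_simps)

lemma ip_scale_left: "ip d (\<lambda>i. c * y i) x = c * ip d y x"
  unfolding ip_def by (simp add: sum_distrib_left algebra_simps)

lemmas ip_linear = ip_add_right ip_diff_right ip_add_left ip_diff_left ip_scale_left ip_scale_right

lemma ip_wsum: "ip d y (wsum T l x) = (\<Sum>t\<in>T. l t * ip d y (x t))"
  unfolding ip_def wsum_def
  by (simp add: sum_distrib_left, subst sum.swap) (simp add: algebra_simps)

lemma ip_le_half_sum: "ip d x y \<le> (ip d x x + ip d y y) / 2"
  using ip_self_nonneg[of d "\<lambda>i. x i - y i"] ip_commute[of d x y] by (simp add: ip_linear)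

text \<open>Convexity of the squared norm: expand one factor, bound each product by
  \<open>ip_le_half_sum\<close>, and absorb half of the left-hand side.\<close>

lemma ip_wsum_self_le:
  assumes "l \<in> weights T"
  shows "ip d (wsum T l x) (wsum T l x) \<le> (\<Sum>t\<in>T. l t * ip d (x t) (x t))"
proof -
  let ?w = "wsum T l x"
  have "ip d ?w ?w = (\<Sum>t\<in>T. l t * ip d ?w (x t))" by (rule ip_wsum)
  also have "\<dots> \<le> (\<Sum>t\<in>T. l t * ((ip d ?w ?w + ip d (x t) (x t)) / 2))"
    using assms by (intro sum_mono mult_left_mono ip_le_half_sum) (auto simp: weights_def)
  also have "\<dots> = (\<Sum>t\<in>T. l t * (ip d ?w ?w / 2) + l t * ip d (x t) (x t) / 2)"
    by (intro sum.cong) (auto simp: algebra_simps add_divide_distrib)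
  also have "\<dots> = sum l T * (ip d ?w ?w / 2) + (\<Sum>t\<in>T. l t * ip d (x t) (x t)) / 2"
    by (simp add: sum.distrib sum_distrib_right sum_divide_distrib)
  finally show ?thesis using assms by (simp add: weights_def)
qed

lemma exists_le_weighted_avg:
  fixes \<phi> :: "'a \<Rightarrow> real"
  assumes "finite T" "l \<in> weights T"
  shows "\<exists>t\<in>T. \<phi> t \<le> (\<Sum>t\<in>T. l t * \<phi> t)"
proof (rule ccontr)
  assume "\<not> ?thesis"
  then have gt: "(\<Sum>t\<in>T. l t * \<phi> t) < \<phi> t" if "t \<in> T" for t using that by force
  let ?a = "\<Sum>t\<in>T. l t * \<phi> t"
  have l: "0 \<le> l t" if "t \<in> T" for t using that assms(2) by (auto simp: weights_def)
  have s: "sum l T = 1" using assms(2) by (auto simp: weights_def)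
  have "(\<Sum>t\<in>T. l t * (\<phi> t - ?a)) = ?a - sum l T * ?a"
    by (simp add: right_diff_distrib sum_subtractf sum_distrib_right)
  then have "(\<Sum>t\<in>T. l t * (\<phi> t - ?a)) = 0" using s by simp
  moreover have "\<forall>t\<in>T. 0 \<le> l t * (\<phi> t - ?a)" using l gt by (intro ballI mult_nonneg_nonneg) (auto simp: less_imp_le)
  ultimately have "\<forall>t\<in>T. l t * (\<phi> t - ?a) = 0"
    using sum_nonneg_eq_0_iff[OF assms(1), of "\<lambda>t. l t * (\<phi> t - ?a)"] by simp
  then have "\<forall>t\<in>T. l t = 0" using gt by fastforce
  then show False using s by simp
qed

text \<open>
  The right-hand side is the expectation of the left-hand side for independent samples \<open>ts\<close> with
  distribution \<open>l\<close>; the samples are chosen one by one so that the conditional expectation never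
  increases.
\<close>

lemma maurey_selection:
  fixes B :: "(nat \<Rightarrow> real) \<Rightarrow> (nat \<Rightarrow> real) \<Rightarrow> real"
  assumes T: "finite T" "l \<in> weights T"
    and sym: "\<And>x y. B x y = B y x"
    and add: "\<And>x y z. B x (\<lambda>i. y i + z i) = B x y + B x z"
    and ws: "\<And>y. B y w = (\<Sum>t\<in>T. l t * B y t)"
  shows "\<exists>ts. set ts \<subseteq> T \<and> length ts = k \<and>
    B (\<lambda>i. a i + lsum ts i) (\<lambda>i. a i + lsum ts i)
      \<le> B a a + 2 * real k * B a w + real k * (\<Sum>t\<in>T. l t * B t t) + real k * (real k - 1) * B w w"
proof (induction k arbitrary: a)
  case 0
  show ?case by (intro exI[of _ "[]"]) (simp add: lsum_def)
next
  case (Suc k)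
  let ?m = "\<Sum>t\<in>T. l t * B t t"
  have s: "sum l T = 1" using T by (simp add: weights_def)
  have add': "B (\<lambda>i. y i + z i) x = B y x + B z x" for x y z
    using add[of x y z] by (simp add: sym)
  \<comment> \<open>The bound that the induction hypothesis gives once \<open>t\<close> is the first
    sample; its average over \<open>l\<close> is the claimed bound.\<close>
  define \<phi> where "\<phi> t = B (\<lambda>i. a i + t i) (\<lambda>i. a i + t i) + 2 * real k * B (\<lambda>i. a i + t i) w
    + real k * ?m + real k * (real k - 1) * B w w" for t
  define c where "c = B a a + 2 * real k * B a w + real k * ?m + real k * (real k - 1) * B w w"
  have \<phi>: "\<phi> t = c + 2 * B a t + B t t + 2 * real k * B w t" for t
    unfolding \<phi>_def c_def by (simp add: add add' sym[of t a] sym[of t w] algebra_simps)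
  have "(\<Sum>t\<in>T. l t * \<phi> t) = (\<Sum>t\<in>T. l t * c + 2 * (l t * B a t) + l t * B t t + 2 * real k * (l t * B w t))"
    unfolding \<phi> by (intro sum.cong) (auto simp: algebra_simps)
  also have "\<dots> = sum l T * c + 2 * B a w + ?m + 2 * real k * B w w"
    by (simp add: sum.distrib sum_distrib_right sum_distrib_left ws)
  also have "\<dots> = B a a + 2 * real (Suc k) * B a w + real (Suc k) * ?m + real (Suc k) * (real (Suc k) - 1) * B w w"
    unfolding s c_def by (simp add: algebra_simps)
  finally obtain t where t: "t \<in> T" "\<phi> t \<le> B a a + 2 * real (Suc k) * B a w + real (Suc k) * ?m
      + real (Suc k) * (real (Suc k) - 1) * B w w"
    using exists_le_weighted_avg[OF T, of \<phi>] by auto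
  obtain ts where ts: "set ts \<subseteq> T" "length ts = k"
    "B (\<lambda>i. (a i + t i) + lsum ts i) (\<lambda>i. (a i + t i) + lsum ts i) \<le> \<phi> t"
    using Suc.IH[of "\<lambda>i. a i + t i"] unfolding \<phi>_def by blast
  show ?case
    using t ts by (intro exI[of _ "t # ts"]) (auto simp: lsum_def add.assoc)
qed

text \<open>Maurey selection for the form \<open>B\<close> that measures the excess of energy over
  the guaranteed multiple of the squared norm. \<open>B\<close> is nonnegative at sums of
  \<open>k\<close> elements by \<open>lo\<close> and small at single elements by \<open>up\<close>,
  which bounds it from below at \<open>w\<close>. Only norms above \<open>5 * \<epsilon>\<close>
  matter, so \<open>K\<close> bounds the sample sizes.\<close>

lemma energy_wsum_ge:
  fixes \<epsilon> :: real
  assumes T: "finite T" "\<And>t. t \<in> T \<Longrightarrow> ip d t t = 1"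
    and \<epsilon>: "0 < \<epsilon>"
    and up: "\<And>t. t \<in> T \<Longrightarrow> energy m d M t \<le> real m * (1 + \<epsilon>)"
    and lo: "\<And>ts. set ts \<subseteq> T \<Longrightarrow> length ts \<le> K \<Longrightarrow>
       real m * (1 - \<epsilon> * sqrt (length ts)) * ip d (lsum ts) (lsum ts) \<le> energy m d M (lsum ts)"
    and K: "1 / (25 * \<epsilon>\<^sup>2) + 2 \<le> real K"
    and l: "l \<in> weights T"
  defines "w \<equiv> wsum T l (\<lambda>t. t)"
  shows "sqrt (real m) * (sqrt (ip d w w) - 5 * \<epsilon>) \<le> sqrt (energy m d M w)"
proof (cases "sqrt (ip d w w) \<le> 5 * \<epsilon>")
  case True
  then have "sqrt (real m) * (sqrt (ip d w w) - 5 * \<epsilon>) \<le> 0"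
    by (intro mult_nonneg_nonpos) auto
  also have "0 \<le> sqrt (energy m d M w)" by (simp add: energy_nonneg)
  finally show ?thesis .
next
  case False
  define \<rho> where "\<rho> = sqrt (ip d w w)"
  have \<rho>: "5 * \<epsilon> < \<rho>" "0 < \<rho>" using False \<epsilon> unfolding \<rho>_def by linarith+
  have \<rho>2: "ip d w w = \<rho>\<^sup>2" by (simp add: \<rho>_def ip_self_nonneg)
  have l01: "sum l T = 1" "\<And>t. t \<in> T \<Longrightarrow> 0 \<le> l t" using l by (auto simp: weights_def)
  have "ip d w w \<le> (\<Sum>t\<in>T. l t * ip d t t)" unfolding w_def by (rule ip_wsum_self_le[OF l])
  also have "\<dots> = 1" using T l01 by simp
  finally have \<rho>1: "\<rho> \<le> 1" by (simp add: \<rho>_def)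
  \<comment> \<open>With about \<open>1 / \<rho>\<^sup>2\<close> samples the sampling error \<open>1 / k\<close> of the squared norm has the order of \<open>\<rho>\<^sup>2\<close>,
    and the admissible relative error \<open>\<epsilon> \<surd>k\<close> is \<open>O(\<epsilon> / \<rho>)\<close>.\<close>
  define k where "k = nat \<lceil>1 / \<rho>\<^sup>2\<rceil> + 1"
  have k: "1 / \<rho>\<^sup>2 \<le> real k - 1" "real k \<le> 1 / \<rho>\<^sup>2 + 2"
    unfolding k_def using \<rho> by (auto intro: real_nat_ceiling_ge) linarith
  have k0: "0 < real k" unfolding k_def by linarith
  have "1 / \<rho>\<^sup>2 \<le> 1 / (25 * \<epsilon>\<^sup>2)"
  proof (rule divide_left_mono)
    have "(5 * \<epsilon>)\<^sup>2 \<le> \<rho>\<^sup>2" using \<rho> \<epsilon> by (intro power_mono) auto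
    then show "25 * \<epsilon>\<^sup>2 \<le> \<rho>\<^sup>2" by (simp add: power_mult_distrib)
  qed (use \<rho> \<epsilon> in auto)
  then have kK: "k \<le> K" using k K by linarith
  define s where "s = sqrt (real k)"
  have s: "0 \<le> s" "s\<^sup>2 = real k" by (auto simp: s_def)
  have "(s * \<rho>)\<^sup>2 = real k * \<rho>\<^sup>2" by (simp add: power_mult_distrib s)
  also have "\<dots> \<le> (1 / \<rho>\<^sup>2 + 2) * \<rho>\<^sup>2" using k by (intro mult_right_mono) auto
  also have "\<dots> = 1 + 2 * \<rho>\<^sup>2" using \<rho> by (simp add: field_simps)
  also have "\<dots> \<le> 2\<^sup>2" using \<rho> \<rho>1 by (simp add: power_le_one[of \<rho> 2] order_trans[OF mult_left_mono[of "\<rho>\<^sup>2" 1 2]])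
  finally have s\<rho>: "s * \<rho> \<le> 2" by (rule power2_le_imp_le) simp
  define c where "c = real m * (1 - \<epsilon> * s)"
  define B where "B x y = (\<Sum>j<m. ip d (M j) x * ip d (M j) y) - c * ip d x y" for x y
  have Bself: "B x x = energy m d M x - c * ip d x x" for x
    by (simp add: B_def energy_def power2_eq_square)
  have "\<exists>ts. set ts \<subseteq> T \<and> length ts = k \<and>
    B (\<lambda>i. (\<lambda>_. 0) i + lsum ts i) (\<lambda>i. (\<lambda>_. 0) i + lsum ts i)
      \<le> B (\<lambda>_. 0) (\<lambda>_. 0) + 2 * real k * B (\<lambda>_. 0) w + real k * (\<Sum>t\<in>T. l t * B t t) + real k * (real k - 1) * B w w"
  proof (rule maurey_selection[OF T(1) l])
    show "B x y = B y x" for x y by (simp add: B_def ip_commute mult.commute)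
    show "B x (\<lambda>i. y i + z i) = B x y + B x z" for x y z
      by (simp add: B_def ip_linear sum.distrib algebra_simps)
    show "B y w = (\<Sum>t\<in>T. l t * B y t)" for y
    proof -
      have "(\<Sum>j<m. ip d (M j) y * (\<Sum>t\<in>T. l t * ip d (M j) t)) = (\<Sum>t\<in>T. l t * (\<Sum>j<m. ip d (M j) y * ip d (M j) t))"
        by (simp add: sum_distrib_left, subst sum.swap) (simp add: algebra_simps)
      then show ?thesis
        unfolding B_def w_def ip_wsum right_diff_distrib sum_subtractf
        by (simp add: sum_distrib_left algebra_simps)
    qed
  qed
  then obtain ts where ts: "set ts \<subseteq> T" "length ts = k"
    "B (lsum ts) (lsum ts) \<le> real k * (\<Sum>t\<in>T. l t * B t t) + real k * (real k - 1) * B w w"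
    by (auto simp: B_def ip_def)
  have "0 \<le> B (lsum ts) (lsum ts)"
    using lo[of ts] ts kK by (simp add: Bself c_def s_def)
  with ts have "0 \<le> real k * ((\<Sum>t\<in>T. l t * B t t) + (real k - 1) * B w w)"
    by (simp add: algebra_simps)
  then have 1: "0 \<le> (\<Sum>t\<in>T. l t * B t t) + (real k - 1) * B w w"
    using k0 by (simp add: zero_le_mult_iff)
  have "(\<Sum>t\<in>T. l t * B t t) \<le> (\<Sum>t\<in>T. l t * (real m * (\<epsilon> * (1 + s))))"
  proof (intro sum_mono mult_left_mono l01)
    fix t assume "t \<in> T"
    then show "B t t \<le> real m * (\<epsilon> * (1 + s))"
      using up[of t] T(2)[of t] by (simp add: Bself c_def algebra_simps)
  qed
  also have "\<dots> = real m * (\<epsilon> * (1 + s))" using l01 by (simp flip: sum_distrib_right)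
  finally have 2: "- (real m * (\<epsilon> * (1 + s))) \<le> (real k - 1) * B w w" using 1 by linarith
  \<comment> \<open>If \<open>B w w\<close> is negative, its factor \<open>k - 1\<close> may be
    lowered to \<open>1 / \<rho>\<^sup>2\<close>; the \<open>+ 1\<close> in \<open>k\<close> is
    there for this.\<close>
  have "- (real m * (\<epsilon> * (1 + s)) * \<rho>\<^sup>2) \<le> B w w"
  proof (cases "0 \<le> B w w")
    case True
    have "0 \<le> real m * (\<epsilon> * (1 + s)) * \<rho>\<^sup>2" using \<epsilon> s by simp
    then show ?thesis using True by linarith
  next
    case False
    then have "(real k - 1) * B w w \<le> (1 / \<rho>\<^sup>2) * B w w"
      using k by (intro mult_right_mono_neg) auto
    with 2 have "- (real m * (\<epsilon> * (1 + s))) \<le> B w w / \<rho>\<^sup>2" by simp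
    then show ?thesis using \<rho> by (simp add: pos_le_divide_eq)
  qed
  then have 3: "energy m d M w \<ge> real m * (\<rho>\<^sup>2 - \<epsilon> * (2 * (s * \<rho>) * \<rho> + \<rho> * \<rho>))"
    by (simp add: Bself c_def \<rho>2 algebra_simps power2_eq_square)
  \<comment> \<open>Source of the constant 5: \<open>s * \<rho> \<le> 2\<close> gives 4 and
    \<open>\<rho> \<le> 1\<close> gives 1.\<close>
  have "2 * (s * \<rho>) * \<rho> + \<rho> * \<rho> \<le> 2 * 2 * \<rho> + 1 * \<rho>"
    using s\<rho> \<rho> \<rho>1 by (intro add_mono mult_right_mono) (auto simp: mult.commute)
  then have "\<epsilon> * (2 * (s * \<rho>) * \<rho> + \<rho> * \<rho>) \<le> \<epsilon> * (5 * \<rho>)" using \<epsilon> by (intro mult_left_mono) auto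
  moreover have "5 * \<epsilon> * (5 * \<epsilon>) \<le> 5 * \<epsilon> * \<rho>" using \<rho> \<epsilon> by (intro mult_left_mono) auto
  ultimately have "(\<rho> - 5 * \<epsilon>)\<^sup>2 \<le> \<rho>\<^sup>2 - \<epsilon> * (2 * (s * \<rho>) * \<rho> + \<rho> * \<rho>)"
    by (simp add: power2_eq_square algebra_simps)
  then have "real m * (\<rho> - 5 * \<epsilon>)\<^sup>2 \<le> real m * (\<rho>\<^sup>2 - \<epsilon> * (2 * (s * \<rho>) * \<rho> + \<rho> * \<rho>))"
    by (intro mult_left_mono) auto
  with 3 have "real m * (\<rho> - 5 * \<epsilon>)\<^sup>2 \<le> energy m d M w" by linarith
  then have "sqrt (real m * (\<rho> - 5 * \<epsilon>)\<^sup>2) \<le> sqrt (energy m d M w)" by (rule real_sqrt_le_mono)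
  then show ?thesis using \<rho> by (simp add: real_sqrt_mult \<rho>_def)
qed

section \<open>Duality\<close>

text \<open>The segment from \<open>l\<close> towards the vertex at \<open>t\<close>, along which
  the near-minimiser is tested in the duality argument.\<close>

lemma weights_move:
  assumes "finite T" "l \<in> weights T" "t \<in> T" "0 \<le> \<theta>" "\<theta> \<le> 1"
  shows "(\<lambda>s. (1 - \<theta>) * l s + \<theta> * of_bool (s = t)) \<in> weights T"
  using assms by (auto simp: weights_def sum.distrib of_bool_def simp flip: sum_distrib_left)

lemma sum_weights_move:
  fixes g :: "'a \<Rightarrow> real"
  assumes "finite T" "t \<in> T"
  shows "(\<Sum>s\<in>T. ((1 - \<theta>) * l s + \<theta> * of_bool (s = t)) * g s) = (\<Sum>s\<in>T. l s * g s) + \<theta> * (g t - (\<Sum>s\<in>T. l s * g s))"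
proof -
  have "(\<Sum>s\<in>T. ((1 - \<theta>) * l s + \<theta> * of_bool (s = t)) * g s)
      = (\<Sum>s\<in>T. (1 - \<theta>) * (l s * g s) + \<theta> * (if s = t then g s else 0))"
    by (intro sum.cong) (auto simp: algebra_simps)
  also have "\<dots> = (1 - \<theta>) * (\<Sum>s\<in>T. l s * g s) + \<theta> * g t"
    using assms by (simp add: sum.distrib flip: sum_distrib_left)
  finally show ?thesis by (simp add: algebra_simps)
qed

lemma exists_near_minimiser:
  fixes \<phi> :: "'a \<Rightarrow> real"
  assumes "C \<noteq> {}" "\<And>x. x \<in> C \<Longrightarrow> 0 \<le> \<phi> x" "0 < \<kappa>"
  shows "\<exists>x\<in>C. \<forall>y\<in>C. \<phi> x < \<phi> y + \<kappa>"
proof -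
  have bdd: "bdd_below (\<phi> ` C)" using assms(2) by (auto intro!: bdd_belowI2)
  have "Inf (\<phi> ` C) < Inf (\<phi> ` C) + \<kappa>" using assms(3) by simp
  then obtain x where "x \<in> C" "\<phi> x < Inf (\<phi> ` C) + \<kappa>"
    using cInf_less_iff[of "\<phi> ` C"] bdd assms(1) by (metis (no_types, lifting) image_iff image_is_empty)
  moreover have "Inf (\<phi> ` C) \<le> \<phi> y" if "y \<in> C" for y using that bdd by (intro cInf_lower) auto
  ultimately show ?thesis by (meson add_le_cancel_right order_less_le_trans)
qed

text \<open>Concavity of the root; the squared right-hand side exceeds \<open>a + b\<close> by a
  square.\<close>

lemma sqrt_le_tangent:
  assumes "0 < a" "0 \<le> a + b"
  shows "sqrt (a + b) \<le> sqrt a + b / (2 * sqrt a)"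
proof (rule real_le_lsqrt)
  let ?s = "sqrt a"
  have s: "0 < ?s" "?s * ?s = a" using assms by auto
  have "0 \<le> (2 * a + b) / (2 * ?s)" using assms s by simp
  also have "(2 * a + b) / (2 * ?s) = ?s + b / (2 * ?s)" using s by (simp add: field_simps)
  finally show "0 \<le> ?s + b / (2 * ?s)" .
  have "a + b \<le> a + b + (b / (2 * ?s))\<^sup>2" by simp
  also have "\<dots> = (?s + b / (2 * ?s))\<^sup>2" using s(1) assms(1) by (simp add: power2_sum)
  finally show "a + b \<le> (?s + b / (2 * ?s))\<^sup>2" .
qed

text \<open>
  The vector \<open>u\<close> is the gradient of \<open>V sqrt (|\<cdot>|\<^sup>2 + e\<^sup>2)\<close> at a near-minimiser \<open>w\<close> of the Lagrangian
  \<open>\<phi>\<close>. The smoothing by \<open>e\<close> avoids the singularity at \<open>w = 0\<close>, and the slack \<open>\<eta>\<close> makes compactness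
  of the simplex unnecessary.
\<close>

lemma weights_ball_duality:
  fixes x :: "'a \<Rightarrow> nat \<Rightarrow> real" and c :: "'a \<Rightarrow> real"
  assumes T: "finite T" and V: "0 \<le> V" and \<eta>: "0 < \<eta>"
    and hyp: "\<And>l. l \<in> weights T \<Longrightarrow>
      (\<Sum>t\<in>T. l t * c t) \<le> V * sqrt (ip m (wsum T l x) (wsum T l x))"
  shows "\<exists>u. ip m u u \<le> V\<^sup>2 \<and> (\<forall>t\<in>T. c t - \<eta> \<le> ip m u (x t))"
proof (cases "T = {}")
  case True
  then show ?thesis by (intro exI[of _ "\<lambda>_. 0"]) (simp add: ip_def)
next
  case False
  then obtain t0 where t0: "t0 \<in> T" by blast
  have "(\<lambda>s. of_bool (s = t0)) \<in> weights T"
    using t0 T by (auto simp: weights_def of_bool_def)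
  then have ne: "weights T \<noteq> {}" by blast
  \<comment> \<open>The loss \<eta> is split: \<open>\<eta> / 2\<close> for the smoothing,
    \<open>\<eta> / 4\<close> for the second-order term \<open>\<theta> * L\<close>, and
    \<open>\<eta> / 4\<close> for near-minimality.\<close>
  define e where "e = \<eta> / (2 * (V + 1))"
  have e: "0 < e" "V * e \<le> \<eta> / 2"
    using V \<eta> by (auto simp: e_def field_simps)
  define X where "X = (\<Sum>t\<in>T. ip m (x t) (x t))"
  have X: "0 \<le> X" unfolding X_def by (intro sum_nonneg ip_self_nonneg)
  have Xt: "ip m (x t) (x t) \<le> X" if "t \<in> T" for t
    unfolding X_def using T that by (intro member_le_sum ip_self_nonneg) auto
  define L where "L = V * (4 * X) / (2 * e)"
  have L: "0 \<le> L" using V X e by (simp add: L_def)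
  define \<theta> where "\<theta> = min 1 (\<eta> / (4 * (L + 1)))"
  have \<theta>: "0 < \<theta>" "\<theta> \<le> 1" "\<theta> * L \<le> \<eta> / 4"
  proof -
    show "0 < \<theta>" "\<theta> \<le> 1" using \<eta> L by (auto simp: \<theta>_def)
    have "\<theta> * L \<le> \<eta> / (4 * (L + 1)) * L" using L by (intro mult_right_mono) (auto simp: \<theta>_def)
    also have "\<dots> \<le> \<eta> / 4" using L \<eta> by (simp add: field_simps)
    finally show "\<theta> * L \<le> \<eta> / 4" .
  qed
  define W where "W l = wsum T l x" for l
  define c' where "c' l = (\<Sum>t\<in>T. l t * c t)" for l
  define \<phi> where "\<phi> l = V * sqrt (ip m (W l) (W l) + e\<^sup>2) - c' l" for l
  have "0 \<le> \<phi> l" if "l \<in> weights T" for l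
  proof -
    have "c' l \<le> V * sqrt (ip m (W l) (W l))" using hyp[OF that] by (simp add: c'_def W_def)
    also have "\<dots> \<le> V * sqrt (ip m (W l) (W l) + e\<^sup>2)" using V by (intro mult_left_mono) auto
    finally show ?thesis by (simp add: \<phi>_def)
  qed
  then obtain l where l: "l \<in> weights T" and min: "\<And>l'. l' \<in> weights T \<Longrightarrow> \<phi> l < \<phi> l' + \<theta> * (\<eta> / 4)"
    using exists_near_minimiser[OF ne, of \<phi> "\<theta> * (\<eta> / 4)"] \<theta> \<eta> by auto
  define w where "w = W l"
  define S where "S = sqrt (ip m w w + e\<^sup>2)"
  have pos: "0 < ip m w w + e\<^sup>2" using e ip_self_nonneg[of m w] by (intro add_nonneg_pos) auto
  have S: "0 < S" "S\<^sup>2 = ip m w w + e\<^sup>2" using pos by (auto simp: S_def)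
  have eS: "e \<le> S" unfolding S_def using e ip_self_nonneg[of m w] by (intro real_le_rsqrt) auto
  define u where "u = (\<lambda>i. V / S * w i)"
  have ipu: "ip m u y = V / S * ip m w y" for y unfolding u_def by (rule ip_scale_left)
  have "ip m w w / S\<^sup>2 \<le> 1" using S pos by (simp add: divide_le_eq_1)
  then have "V\<^sup>2 * (ip m w w / S\<^sup>2) \<le> V\<^sup>2 * 1" by (intro mult_left_mono) auto
  then have uu: "ip m u u \<le> V\<^sup>2"
    unfolding ipu unfolding u_def ip_scale_right by (simp add: power2_eq_square)
  have uw: "V * sqrt (ip m w w) - \<eta> / 2 \<le> ip m u w"
  proof -
    define a where "a = sqrt (ip m w w)"
    have a: "0 \<le> a" "a\<^sup>2 = ip m w w" by (auto simp: a_def ip_self_nonneg)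
    have "S \<le> a + e" unfolding S_def using a e
      by (intro real_le_lsqrt) (auto simp: power2_sum)
    have "(a - e) * S \<le> a\<^sup>2"
    proof (cases "e \<le> a")
      case True
      then have "(a - e) * S \<le> (a - e) * (a + e)" using \<open>S \<le> a + e\<close> by (intro mult_left_mono) auto
      also have "\<dots> \<le> a\<^sup>2" by (simp add: algebra_simps power2_eq_square)
      finally show ?thesis .
    next
      case False
      then have "(a - e) * S \<le> 0" using S by (intro mult_nonpos_nonneg) auto
      then show ?thesis using zero_le_power2[of a] by linarith
    qed
    then have "a - e \<le> ip m w w / S" using S a by (simp add: pos_le_divide_eq)
    then have "V * (a - e) \<le> V * (ip m w w / S)" using V by (intro mult_left_mono)
    then show ?thesis using e by (simp add: ipu a_def right_diff_distrib)
  qed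
  have "c t - \<eta> \<le> ip m u (x t)" if t: "t \<in> T" for t
  proof -
    \<comment> \<open>A step of length \<theta> towards \<open>t\<close>. The slack of the
      near-minimiser is proportional to \<theta>, so dividing by \<theta> leaves an approximate
      first-order condition.\<close>
    define l' where "l' = (\<lambda>s. (1 - \<theta>) * l s + \<theta> * of_bool (s = t))"
    have l': "l' \<in> weights T" unfolding l'_def using \<theta> T l t by (intro weights_move) auto
    define y where "y = (\<lambda>i. x t i - w i)"
    have c'l: "c' l' = c' l + \<theta> * (c t - c' l)"
      unfolding c'_def l'_def by (rule sum_weights_move[OF T t])
    have W': "W l' = (\<lambda>i. w i + \<theta> * y i)"
      unfolding W_def l'_def wsum_def y_def w_def sum_weights_move[OF T t] ..
    define b where "b = 2 * \<theta> * ip m w y + \<theta>\<^sup>2 * ip m y y"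
    have ipW': "ip m (W l') (W l') = ip m w w + b"
      unfolding W' b_def by (simp add: ip_linear ip_commute[of m y w] algebra_simps power2_eq_square)
    have "sqrt (ip m w w + e\<^sup>2 + b) \<le> S + b / (2 * S)"
      unfolding S_def using pos ip_self_nonneg[of m "W l'"]
      by (intro sqrt_le_tangent) (auto simp: ipW' intro: order_trans[OF _ add_right_mono])
    then have "V * sqrt (ip m w w + e\<^sup>2 + b) \<le> V * (S + b / (2 * S))"
      using V by (intro mult_left_mono)
    then have "\<phi> l' \<le> V * (S + b / (2 * S)) - c' l'"
      unfolding \<phi>_def ipW' by (simp add: algebra_simps)
    moreover have "\<phi> l = V * S - c' l" by (simp add: \<phi>_def S_def w_def)
    ultimately have "0 \<le> V * (b / (2 * S)) - \<theta> * (c t - c' l) + \<theta> * (\<eta> / 4)"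
      using min[OF l'] by (simp add: c'l algebra_simps)
    also have "V * (b / (2 * S)) = \<theta> * ip m u y + \<theta> * (\<theta> * (V * ip m y y / (2 * S)))"
      unfolding b_def ipu using S by (simp add: field_simps power2_eq_square)
    finally have "0 \<le> \<theta> * (ip m u y + \<theta> * (V * ip m y y / (2 * S)) - (c t - c' l) + \<eta> / 4)"
      by (simp add: algebra_simps)
    then have 1: "0 \<le> ip m u y + \<theta> * (V * ip m y y / (2 * S)) - (c t - c' l) + \<eta> / 4"
      using \<theta> by (simp add: zero_le_mult_iff)
    have "V * ip m y y / (2 * S) \<le> L"
      unfolding L_def
    proof (intro frac_le mult_left_mono)
      have "ip m w w \<le> (\<Sum>t\<in>T. l t * ip m (x t) (x t))"
        unfolding w_def W_def by (rule ip_wsum_self_le[OF l])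
      also have "\<dots> \<le> (\<Sum>t\<in>T. l t * X)"
        using l Xt by (intro sum_mono mult_left_mono) (auto simp: weights_def)
      also have "\<dots> = X" using l by (simp add: weights_def flip: sum_distrib_right)
      finally have "ip m w w \<le> X" .
      \<comment> \<open>With the bound on \<open>w\<close> this yields
        \<open>ip m y y \<le> 2 * ip m (x t) (x t) + 2 * ip m w w\<close>, hence the factor 4 in
        \<open>L\<close>.\<close>
      moreover have "0 \<le> ip m (\<lambda>i. x t i + w i) (\<lambda>i. x t i + w i)" by (rule ip_self_nonneg)
      ultimately show "ip m y y \<le> 4 * X"
        using Xt[OF t] unfolding y_def by (simp add: ip_linear ip_commute[of m w "x t"])
    qed (use V X e eS ip_self_nonneg in auto)
    then have "\<theta> * (V * ip m y y / (2 * S)) \<le> \<theta> * L" using \<theta> by (intro mult_left_mono) auto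
    then have "0 \<le> ip m u y - (c t - c' l) + \<eta> / 2" using 1 \<theta>(3) by linarith
    moreover have "ip m u y = ip m u (x t) - ip m u w" by (simp add: y_def ip_diff_right)
    moreover have "c' l \<le> V * sqrt (ip m w w)" using hyp[OF l] by (simp add: c'_def w_def W_def)
    ultimately show ?thesis using uw by linarith
  qed
  then show ?thesis using uu by blast
qed

section \<open>The embedding\<close>

lemma norm2_eq_ip: "norm2 d x = sqrt (ip d x x)"
  unfolding norm2_def L2_set_def ip_def by (simp add: power2_eq_square)

lemma ip_le_norm2: "ip d x y \<le> norm2 d x * norm2 d y"
proof -
  have "ip d x y \<le> (\<Sum>i<d. \<bar>x i\<bar> * \<bar>y i\<bar>)"
    unfolding ip_def by (intro sum_mono) (simp flip: abs_mult)
  also have "\<dots> \<le> norm2 d x * norm2 d y" unfolding norm2_def by (rule L2_set_mult_ineq)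
  finally show ?thesis .
qed

text \<open>\<open>A\<close> is a good sign matrix scaled by \<open>1 / sqrt m\<close>, chosen
  before \<open>v\<close>. Duality gives a one-sided bound on \<open>T\<close>, and closure of
  \<open>T\<close> under negation makes it two-sided.\<close>

lemma exists_terminal_projection:
  assumes T: "finite T" "\<And>t. t \<in> T \<Longrightarrow> ip d t t = 1"
    and symT: "\<And>t. t \<in> T \<Longrightarrow> (\<lambda>i. - t i) \<in> T"
    and \<epsilon>: "0 < \<epsilon>" "\<epsilon> \<le> 1" and m0: "0 < m"
    and m: "real (card T) * exp (- (real m * \<epsilon>\<^sup>2 / 16)) \<le> 1 / 4"
  shows "\<exists>A. (\<forall>t\<in>T. \<bar>ip m (\<lambda>j. ip d (A j) t) (\<lambda>j. ip d (A j) t) - 1\<bar> \<le> \<epsilon>) \<and>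
    (\<forall>v. \<exists>u. ip m u u \<le> ip d v v \<and>
      (\<forall>t\<in>T. \<bar>ip m u (\<lambda>j. ip d (A j) t) - ip d v t\<bar> \<le> 6 * \<epsilon> * norm2 d v))"
proof -
  define K where "K = nat \<lceil>1 / (25 * \<epsilon>\<^sup>2) + 2\<rceil>"
  have K: "1 / (25 * \<epsilon>\<^sup>2) + 2 \<le> real K" unfolding K_def by (rule real_nat_ceiling_ge)
  obtain M where up: "\<And>t. t \<in> T \<Longrightarrow> energy m d M t \<le> real m * (1 + \<epsilon>)"
    and lo: "\<And>ts. set ts \<subseteq> T \<Longrightarrow> length ts \<le> K \<Longrightarrow>
       real m * (1 - \<epsilon> * sqrt (length ts)) * ip d (lsum ts) (lsum ts) \<le> energy m d M (lsum ts)"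
    using exists_sgn_mat[OF T less_imp_le[OF \<epsilon>(1)] \<epsilon>(2) m, of K] by blast
  define A where "A j = (\<lambda>i. 1 / sqrt (real m) * M j i)" for j
  define P where "P x = (\<lambda>j. ip d (A j) x)" for x
  have PP: "ip m (P x) (P x) = energy m d M x / real m" for x
  proof -
    have "ip m (P x) (P x) = (\<Sum>j<m. 1 / real m * (ip d (M j) x)\<^sup>2)"
      unfolding P_def A_def ip_scale_left using m0
      by (simp add: ip_def[of m] power2_eq_square flip: sum_divide_distrib)
    then show ?thesis by (simp add: energy_def flip: sum_divide_distrib)
  qed
  have "\<bar>ip m (P t) (P t) - 1\<bar> \<le> \<epsilon>" if t: "t \<in> T" for t
  proof -
    have "lsum [t] = t" by (simp add: lsum_def)
    moreover have "1 \<le> real K" using K \<epsilon> by (smt (verit) divide_nonneg_nonneg zero_le_power2)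
    ultimately have "real m * (1 - \<epsilon>) \<le> energy m d M t" using lo[of "[t]"] t T(2)[OF t] by simp
    then show ?thesis using up[OF t] m0 unfolding PP abs_le_iff by (simp add: field_simps)
  qed
  moreover have "\<exists>u. ip m u u \<le> ip d v v \<and> (\<forall>t\<in>T. \<bar>ip m u (P t) - ip d v t\<bar> \<le> 6 * \<epsilon> * norm2 d v)" for v
  proof -
    let ?V = "norm2 d v"
    have V: "0 \<le> ?V" "?V\<^sup>2 = ip d v v" by (auto simp: norm2_eq_ip ip_self_nonneg)
    have "\<exists>u. ip m u u \<le> ?V\<^sup>2 \<and> (\<forall>t\<in>T. ip d v t - 6 * \<epsilon> * ?V \<le> ip m u (P t))"
    proof (cases "?V = 0")
      case True
      then show ?thesis
        using ip_le_norm2[of d v] by (intro exI[of _ "\<lambda>_. 0"]) (auto simp: ip_def[of m])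
    next
      case False
      then have "0 < ?V" using V by simp
      \<comment> \<open>The error is \<open>5 * \<epsilon>\<close> from
        \<open>energy_wsum_ge\<close> plus \<epsilon> as duality slack, both times
        \<open>?V\<close>. The slack must be positive, hence the separate case
        \<open>?V = 0\<close>.\<close>
      have "\<exists>u. ip m u u \<le> ?V\<^sup>2 \<and> (\<forall>t\<in>T. (ip d v t - 5 * \<epsilon> * ?V) - \<epsilon> * ?V \<le> ip m u (P t))"
      proof (rule weights_ball_duality[OF T(1) V(1)])
        show "0 < \<epsilon> * ?V" using \<epsilon> \<open>0 < ?V\<close> by simp
        fix l assume l: "l \<in> weights T"
        define w where "w = wsum T l (\<lambda>t. t)"
        have Pw: "wsum T l P = P w"
          unfolding P_def w_def ip_wsum by (simp add: wsum_def)
        have "(\<Sum>t\<in>T. l t * (ip d v t - 5 * \<epsilon> * ?V)) = ip d v w - sum l T * (5 * \<epsilon> * ?V)"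
          unfolding w_def ip_wsum by (simp add: right_diff_distrib sum_subtractf sum_distrib_right)
        also have "\<dots> \<le> ?V * (norm2 d w - 5 * \<epsilon>)"
          using ip_le_norm2[of d v w] l by (simp add: weights_def algebra_simps)
        also have "\<dots> \<le> ?V * sqrt (ip m (P w) (P w))"
        proof (intro mult_left_mono V)
          have "sqrt (real m) * (sqrt (ip d w w) - 5 * \<epsilon>) \<le> sqrt (energy m d M w)"
            unfolding w_def by (rule energy_wsum_ge[OF T \<epsilon>(1) up lo K l])
          then show "norm2 d w - 5 * \<epsilon> \<le> sqrt (ip m (P w) (P w))"
            using m0 by (simp add: PP norm2_eq_ip real_sqrt_divide pos_le_divide_eq mult.commute)
        qed
        finally show "(\<Sum>t\<in>T. l t * (ip d v t - 5 * \<epsilon> * ?V)) \<le> ?V * sqrt (ip m (wsum T l P) (wsum T l P))"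
          by (simp only: Pw)
      qed
      then show ?thesis by (simp add: algebra_simps)
    qed
    then obtain u where u: "ip m u u \<le> ?V\<^sup>2" "\<And>t. t \<in> T \<Longrightarrow> ip d v t - 6 * \<epsilon> * ?V \<le> ip m u (P t)"
      by blast
    have neg: "ip k x (\<lambda>i. - y i) = - ip k x y" for k x y by (simp add: ip_def sum_negf)
    have "P (\<lambda>i. - t i) = (\<lambda>j. - P t j)" for t by (simp add: P_def neg)
    then have "- ip d v t - 6 * \<epsilon> * ?V \<le> - ip m u (P t)" if "t \<in> T" for t
      using u(2)[OF symT[OF that]] by (simp add: neg)
    then have "\<bar>ip m u (P t) - ip d v t\<bar> \<le> 6 * \<epsilon> * ?V" if "t \<in> T" for t
      using u(2)[OF that] that by (fastforce simp: abs_le_iff)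
    then show ?thesis using u(1) V(2) by auto
  qed
  ultimately show ?thesis unfolding P_def by blast
qed

text \<open>Factor the difference of squares and bound \<open>a + b\<close> below by
  \<open>a\<close>, which then cancels.\<close>

lemma abs_diff_le_of_squares:
  fixes a b k :: real
  assumes "0 \<le> a" "0 \<le> b" "0 \<le> k" "\<bar>a\<^sup>2 - b\<^sup>2\<bar> \<le> k * a"
  shows "\<bar>a - b\<bar> \<le> k"
proof (cases "a = 0")
  case True
  then show ?thesis using assms by simp
next
  case False
  have "\<bar>a - b\<bar> * a \<le> \<bar>a - b\<bar> * (a + b)" using assms by (intro mult_left_mono) auto
  also have "\<dots> = \<bar>a\<^sup>2 - b\<^sup>2\<bar>" using assms by (simp add: power2_eq_square square_diff_square_factored abs_mult)
  also have "\<dots> \<le> k * a" by (rule assms)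
  finally show ?thesis using False assms by simp
qed

section \<open>Distortion at one query point\<close>

lemma norm2_nonneg: "0 \<le> norm2 d x"
  by (simp add: norm2_eq_ip ip_self_nonneg)

lemma norm2_sq: "(norm2 d x)\<^sup>2 = ip d x x"
  by (simp add: norm2_eq_ip ip_self_nonneg)

lemma norm2_add_le: "norm2 d (\<lambda>i. x i + y i) \<le> norm2 d x + norm2 d y"
  unfolding norm2_def by (rule L2_set_triangle_ineq)

lemma norm2_uminus: "norm2 d (\<lambda>i. - x i) = norm2 d x"
  by (simp add: norm2_def L2_set_def)

lemma norm2_diff_le: "norm2 d (\<lambda>i. x i - y i) \<le> norm2 d x + norm2 d y"
  using norm2_add_le[of d x "\<lambda>i. - y i"] by (simp add: norm2_uminus)

lemma terminal_point_distortion: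
  fixes A :: "nat \<Rightarrow> nat \<Rightarrow> real" and p p\<^sub>0 q u :: "nat \<Rightarrow> real"
    and d m :: nat and \<epsilon> r :: real
  defines "P \<equiv> \<lambda>x j. ip d (A j) x"
    and "z \<equiv> \<lambda>i. p i - p\<^sub>0 i" and "v \<equiv> \<lambda>i. q i - p\<^sub>0 i"
  assumes "0 \<le> \<epsilon>" "0 \<le> r"
    and zr: "norm2 d z \<le> 2 * r"
    and near: "norm2 d v \<le> dist2 d p q"
    and uv: "ip m u u \<le> ip d v v"
    and P1: "\<bar>ip m (P z) (P z) - (norm2 d z)\<^sup>2\<bar> \<le> \<epsilon> * (norm2 d z)\<^sup>2"
    and P2: "\<bar>ip m u (P z) - ip d v z\<bar> \<le> 6 * \<epsilon> * norm2 d v * norm2 d z"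
  shows "\<bar>dist2 d p q - dist2 (Suc m) (\<lambda>j. if j < m then P p j else 0)
      (\<lambda>j. if j < m then P p\<^sub>0 j + u j else if j = m then sqrt (ip d v v - ip m u u) else 0)\<bar>
    \<le> 28 * \<epsilon> * r" (is "\<bar>?a - ?b\<bar> \<le> _")
proof (rule abs_diff_le_of_squares)
  let ?D = "norm2 d z" and ?V = "norm2 d v"
  have abs_add_double: "\<bar>x\<bar> \<le> e \<Longrightarrow> \<bar>y\<bar> \<le> e' \<Longrightarrow> \<bar>- x + 2 * y\<bar> \<le> e + 2 * e'" for x y e e' :: real
    by linarith
  have a: "?a = norm2 d (\<lambda>i. z i - v i)" unfolding dist2_def z_def v_def by simp
  have Pz: "P z = (\<lambda>j. P p j - P p\<^sub>0 j)" by (simp add: P_def z_def ip_diff_right)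
  show "0 \<le> ?a" "0 \<le> ?b" by (simp_all add: dist2_def norm2_nonneg)
  show "0 \<le> 28 * \<epsilon> * r" using assms by simp
  have a2: "?a\<^sup>2 = ip d z z - 2 * ip d v z + ip d v v"
    unfolding a norm2_sq by (simp add: ip_linear ip_commute[of d z v])
  have "?b\<^sup>2 = ip m (\<lambda>j. P z j - u j) (\<lambda>j. P z j - u j) + (ip d v v - ip m u u)"
    unfolding dist2_def norm2_sq ip_Suc using uv
    by (simp add: ip_def[of m] Pz algebra_simps)
  \<comment> \<open>The extra coordinate cancels \<open>ip m u u\<close> and supplies
    \<open>ip d v v\<close>, so \<open>?b\<^sup>2\<close> matches \<open>?a\<^sup>2\<close> term by
    term.\<close>
  then have b2: "?b\<^sup>2 = ip m (P z) (P z) - 2 * ip m u (P z) + ip d v v"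
    by (simp add: ip_linear ip_commute[of m "P z" u])
  have "?a\<^sup>2 - ?b\<^sup>2 = ((norm2 d z)\<^sup>2 - ip m (P z) (P z)) + 2 * (ip m u (P z) - ip d v z)"
    unfolding a2 b2 norm2_sq by simp
  then have "\<bar>?a\<^sup>2 - ?b\<^sup>2\<bar> \<le> \<epsilon> * ?D\<^sup>2 + 2 * (6 * \<epsilon> * ?V * ?D)"
    using abs_add_double[of "ip m (P z) (P z) - (norm2 d z)\<^sup>2" _ "ip m u (P z) - ip d v z", OF P1 P2]
    by simp
  also have "\<dots> = \<epsilon> * ?D * (?D + 12 * ?V)" by (simp add: algebra_simps power2_eq_square)
  \<comment> \<open>Since \<open>?V \<le> ?a\<close> and \<open>?D \<le> ?a + ?V\<close>, the
    bracket is at most \<open>2 * ?a + 12 * ?a\<close>; with \<open>?D \<le> 2 * r\<close> this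
    produces 28.\<close>
  also have "\<dots> \<le> \<epsilon> * ?D * (14 * ?a)"
  proof (rule mult_left_mono)
    have "?D \<le> ?a + ?V" using norm2_add_le[of d "\<lambda>i. z i - v i" v] by (simp add: a)
    then show "?D + 12 * ?V \<le> 14 * ?a" using near by linarith
  qed (use assms norm2_nonneg in auto)
  also have "\<dots> \<le> \<epsilon> * (2 * r) * (14 * ?a)"
    using assms(4) zr \<open>0 \<le> ?a\<close> by (intro mult_right_mono mult_left_mono) auto
  finally show "\<bar>?a\<^sup>2 - ?b\<^sup>2\<bar> \<le> 28 * \<epsilon> * r * ?a" by (simp add: algebra_simps)
qed

lemma exists_terminal_embedding:
  assumes X: "X \<subseteq> Rn d" "finite X" "X \<noteq> {}" "\<And>p. p \<in> X \<Longrightarrow> norm2 d p \<le> r"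
    and \<epsilon>: "0 < \<epsilon>" "\<epsilon> \<le> 1" and m0: "0 < m"
    and m: "(real (card X))\<^sup>2 * exp (- (real m * \<epsilon>\<^sup>2 / 16)) \<le> 1 / 4"
  shows "\<exists>f. f \<in> Rn d \<rightarrow> Rn (Suc m) \<and>
    (\<forall>p\<in>X. \<forall>q\<in>Rn d. \<bar>dist2 d p q - dist2 (Suc m) (f p) (f q)\<bar> \<le> 28 * \<epsilon> * r)"
proof -
  have r: "0 \<le> r" using X norm2_nonneg by (meson ex_in_conv order_trans)
  \<comment> \<open>Ordered pairs make the directions closed under negation and bound their number
    by the square of \<open>card X\<close>.\<close>
  define S where "S = {(p, p') \<in> X \<times> X. norm2 d (\<lambda>i. p i - p' i) \<noteq> 0}"
  define dir where "dir = (\<lambda>(p, p'). (\<lambda>i. 1 / norm2 d (\<lambda>i. p i - p' i) * (p i - p' i :: real)))"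
  define T where "T = dir ` S"
  have finS: "finite S" unfolding S_def using X(2) by (auto intro: finite_subset[OF _ finite_cartesian_product[OF X(2) X(2)]])
  then have T1: "finite T" by (simp add: T_def)
  have "card T \<le> card S" unfolding T_def by (rule card_image_le[OF finS])
  also have "\<dots> \<le> card (X \<times> X)" using X(2) by (intro card_mono) (auto simp: S_def)
  finally have "real (card T) \<le> (real (card X))\<^sup>2"
    by (simp add: card_cartesian_product power2_eq_square flip: of_nat_mult)
  then have "real (card T) * exp (- (real m * \<epsilon>\<^sup>2 / 16)) \<le> (real (card X))\<^sup>2 * exp (- (real m * \<epsilon>\<^sup>2 / 16))"
    by (intro mult_right_mono) auto
  with m have mT: "real (card T) * exp (- (real m * \<epsilon>\<^sup>2 / 16)) \<le> 1 / 4" by linarith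
  have T2: "ip d t t = 1" if tT: "t \<in> T" for t
  proof -
    obtain p p' where t: "(p, p') \<in> S" "t = dir (p, p')" using tT unfolding T_def by auto
    then show ?thesis
      unfolding dir_def by (simp only: prod.case ip_scale_left ip_scale_right) (simp add: S_def power2_eq_square flip: norm2_sq)
  qed
  have T3: "(\<lambda>i. - t i) \<in> T" if tT: "t \<in> T" for t
  proof -
    obtain p p' where t: "(p, p') \<in> S" "t = dir (p, p')" using tT unfolding T_def by auto
    have sw: "norm2 d (\<lambda>i. p' i - p i) = norm2 d (\<lambda>i. p i - p' i)"
      using norm2_uminus[of d "\<lambda>i. p i - p' i"] by simp
    have "(\<lambda>i. - t i) = dir (p', p)" unfolding t dir_def by (simp add: sw minus_divide_left)
    moreover have "(p', p) \<in> S" using t sw by (auto simp: S_def)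
    ultimately show ?thesis by (auto simp: T_def)
  qed
  obtain A where A1: "\<And>t. t \<in> T \<Longrightarrow> \<bar>ip m (\<lambda>j. ip d (A j) t) (\<lambda>j. ip d (A j) t) - 1\<bar> \<le> \<epsilon>"
    and A2: "\<And>v. \<exists>u. ip m u u \<le> ip d v v \<and>
      (\<forall>t\<in>T. \<bar>ip m u (\<lambda>j. ip d (A j) t) - ip d v t\<bar> \<le> 6 * \<epsilon> * norm2 d v)"
    using exists_terminal_projection[OF T1 T2 T3 \<epsilon> m0 mT] by blast
  define P where "P = (\<lambda>x j. ip d (A j) x)"
  define g where "g p = (\<lambda>j. if j < m then P p j else 0)" for p
  have zdir: "(\<lambda>i. p i - p' i) = (\<lambda>i. norm2 d (\<lambda>i. p i - p' i) * dir (p, p') i) \<and> dir (p, p') \<in> T \<or> p = p'"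
    if "p \<in> X" "p' \<in> X" for p p'
  proof (cases "norm2 d (\<lambda>i. p i - p' i) = 0")
    case False
    then show ?thesis using that by (auto simp: T_def S_def dir_def)
  next
    case True
    then have "\<forall>i<d. p i = p' i" by (auto simp: norm2_def L2_set_eq_0_iff)
    \<comment> \<open>\<open>norm2 d\<close> sees only the coordinates below \<open>d\<close>;
      membership in \<open>Rn d\<close> settles the others.\<close>
    moreover have "p \<in> Rn d" "p' \<in> Rn d" using that X(1) by auto
    then have "\<forall>i\<ge>d. p i = p' i" by (simp add: Rn_def topspace_Euclidean_space)
    ultimately have "p = p'" by (metis ext not_less)
    then show ?thesis by simp
  qed
  have Pscale: "P (\<lambda>i. c * x i) = (\<lambda>j. c * P x j)" for c x by (simp add: P_def ip_scale_right)
  have z0: "ip k x (\<lambda>_. 0) = 0" for k x by (simp add: ip_def)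
  have P1: "\<bar>ip m (P z) (P z) - (norm2 d z)\<^sup>2\<bar> \<le> \<epsilon> * (norm2 d z)\<^sup>2"
    if "p \<in> X" "p' \<in> X" "z = (\<lambda>i. p i - p' i)" for p p' z
    using zdir[OF that(1,2)]
  proof
    assume *: "(\<lambda>i. p i - p' i) = (\<lambda>i. norm2 d (\<lambda>i. p i - p' i) * dir (p, p') i) \<and> dir (p, p') \<in> T"
    define t where "t = dir (p, p')"
    define D where "D = norm2 d z"
    have z: "z = (\<lambda>i. D * t i)" "t \<in> T" using * that(3) by (auto simp: t_def D_def)
    have "ip m (P z) (P z) - D\<^sup>2 = D\<^sup>2 * (ip m (P t) (P t) - 1)"
      unfolding z(1) Pscale ip_linear by (simp add: algebra_simps power2_eq_square)
    then have "\<bar>ip m (P z) (P z) - D\<^sup>2\<bar> = D\<^sup>2 * \<bar>ip m (P t) (P t) - 1\<bar>" by (simp add: abs_mult)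
    also have "\<dots> \<le> D\<^sup>2 * \<epsilon>" using A1[OF z(2)] unfolding P_def by (intro mult_left_mono) auto
    finally show ?thesis by (simp add: D_def mult.commute)
  qed (use that in \<open>simp add: P_def z0 norm2_sq\<close>)
  have P2: "\<bar>ip m u (P z) - ip d v z\<bar> \<le> 6 * \<epsilon> * norm2 d v * norm2 d z"
    if "p \<in> X" "p' \<in> X" "z = (\<lambda>i. p i - p' i)"
      and u: "\<forall>t\<in>T. \<bar>ip m u (\<lambda>j. ip d (A j) t) - ip d v t\<bar> \<le> 6 * \<epsilon> * norm2 d v" for p p' z u v
    using zdir[OF that(1,2)]
  proof
    assume *: "(\<lambda>i. p i - p' i) = (\<lambda>i. norm2 d (\<lambda>i. p i - p' i) * dir (p, p') i) \<and> dir (p, p') \<in> T"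
    define t where "t = dir (p, p')"
    define D where "D = norm2 d z"
    have D: "0 \<le> D" by (simp add: D_def norm2_nonneg)
    have z: "z = (\<lambda>i. D * t i)" "t \<in> T" using * that(3) by (auto simp: t_def D_def)
    have "ip m u (P z) - ip d v z = D * (ip m u (P t) - ip d v t)"
      unfolding z(1) Pscale ip_linear by (simp add: algebra_simps)
    then have "\<bar>ip m u (P z) - ip d v z\<bar> = D * \<bar>ip m u (P t) - ip d v t\<bar>" using D by (simp add: abs_mult)
    also have "\<dots> \<le> D * (6 * \<epsilon> * norm2 d v)"
      using u z(2) D unfolding P_def by (intro mult_left_mono) auto
    finally show ?thesis by (simp add: D_def mult.commute)
  qed (use that \<epsilon> norm2_nonneg in \<open>simp add: P_def z0\<close>)
  have dXr: "norm2 d (\<lambda>i. p i - p' i) \<le> 2 * r" if "p \<in> X" "p' \<in> X" for p p'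
    using norm2_diff_le[of d p p'] X(4)[of p] X(4)[of p'] that by linarith
  have gRn: "g p \<in> Rn (Suc m)" for p by (simp add: g_def Rn_def topspace_Euclidean_space)
  have ex: "\<exists>y \<in> Rn (Suc m). \<forall>p\<in>X. \<bar>dist2 d p q - dist2 (Suc m) (g p) y\<bar> \<le> 28 * \<epsilon> * r" for q
  proof -
    \<comment> \<open>The nearest terminal, so that the norm of \<open>v\<close> is at most the
      distance from \<open>q\<close> to every terminal.\<close>
    define p0 where "p0 = arg_min_on (\<lambda>p. dist2 d p q) X"
    have p0: "p0 \<in> X" "\<And>p. p \<in> X \<Longrightarrow> dist2 d p0 q \<le> dist2 d p q"
      unfolding p0_def
      using arg_min_if_finite(1)[OF X(2,3)] arg_min_least[OF X(2,3), where f="\<lambda>p. dist2 d p q"] by auto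
    define v where "v = (\<lambda>i. q i - p0 i)"
    obtain u where u: "ip m u u \<le> ip d v v"
      "\<forall>t\<in>T. \<bar>ip m u (\<lambda>j. ip d (A j) t) - ip d v t\<bar> \<le> 6 * \<epsilon> * norm2 d v"
      using A2[of v] by blast
    define y where "y = (\<lambda>j. if j < m then P p0 j + u j
      else if j = m then sqrt (ip d v v - ip m u u) else 0)"
    have nv: "norm2 d v = dist2 d p0 q"
      using norm2_uminus[of d v] by (simp add: dist2_def v_def)
    have "\<bar>dist2 d p q - dist2 (Suc m) (g p) y\<bar> \<le> 28 * \<epsilon> * r" if p: "p \<in> X" for p
      unfolding g_def y_def P_def v_def
    proof (rule terminal_point_distortion)
      show "norm2 d (\<lambda>i. q i - p0 i) \<le> dist2 d p q"
        using nv p0(2)[OF p] by (simp add: v_def)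
    qed (use \<epsilon> r dXr[OF p p0(1)] u(1) P1[OF p p0(1) refl] P2[OF p p0(1) refl u(2)] in
        \<open>simp_all add: v_def P_def\<close>)
    moreover have "y \<in> Rn (Suc m)" by (simp add: y_def Rn_def topspace_Euclidean_space)
    ultimately show ?thesis by blast
  qed
  have exX: "\<bar>dist2 d p q - dist2 (Suc m) (g p) (g q)\<bar> \<le> 28 * \<epsilon> * r" if p: "p \<in> X" and q: "q \<in> X" for p q
  proof -
    \<comment> \<open>A terminal must have image \<open>g q\<close>, since it also serves as a
      reference point. This is the same construction with \<open>p0 = q\<close> and
      \<open>u = 0\<close>.\<close>
    have gq: "g q = (\<lambda>j. if j < m then P q j + (\<lambda>_. 0) j
        else if j = m then sqrt (ip d (\<lambda>i. q i - q i) (\<lambda>i. q i - q i) - ip m (\<lambda>_. 0) (\<lambda>_. 0)) else 0)"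
      by (auto simp: g_def z0)
    have n0: "norm2 d (\<lambda>i. 0) = 0" by (simp add: norm2_eq_ip z0)
    show ?thesis
      unfolding gq unfolding g_def P_def
    proof (rule terminal_point_distortion)
      show "\<bar>ip m (\<lambda>_. 0) (\<lambda>j. ip d (A j) (\<lambda>i. p i - q i)) - ip d (\<lambda>i. q i - q i) (\<lambda>i. p i - q i)\<bar>
        \<le> 6 * \<epsilon> * norm2 d (\<lambda>i. q i - q i) * norm2 d (\<lambda>i. p i - q i)"
        by (simp add: ip_def n0)
    qed (use \<epsilon> r dXr[OF p q] P1[OF p q refl] in \<open>simp_all add: P_def z0 n0 dist2_def norm2_nonneg\<close>)
  qed
  obtain h where h: "\<And>q. h q \<in> Rn (Suc m)"
    "\<And>q p. p \<in> X \<Longrightarrow> \<bar>dist2 d p q - dist2 (Suc m) (g p) (h q)\<bar> \<le> 28 * \<epsilon> * r"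
    using ex by metis
  show ?thesis
  proof (intro exI[of _ "\<lambda>q. if q \<in> X then g q else h q"] conjI ballI)
    show "(\<lambda>q. if q \<in> X then g q else h q) \<in> Rn d \<rightarrow> Rn (Suc m)"
      using gRn h(1) by auto
  qed (use h(2) exX in auto)
qed

text \<open>\<open>max 2\<close> keeps the logarithm positive for \<open>n = 1\<close>, where
  dimension 0 cannot record unbounded distances.\<close>

theorem theorem4p3:
  shows "\<exists>C::real. C > 0 \<and>
    (\<forall>(d::nat) (n::nat) (\<alpha>::real) (r::real) (X::(nat \<Rightarrow> real) set).
       0 < \<alpha> \<and> \<alpha> < 1 \<and> r > 0 \<and>
       X \<subseteq> Rn d \<and> finite X \<and> card X = n \<and>
       (\<forall>p\<in>X. norm2 d p \<le> r) \<and> (\<lambda>i. 0) \<in> X \<longrightarrow>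
       (\<exists>(m::nat) (f::(nat \<Rightarrow> real) \<Rightarrow> (nat \<Rightarrow> real)).
          real m \<le> C * (1 / \<alpha>\<^sup>2) * ln (max 2 (real n)) \<and>
          f \<in> Rn d \<rightarrow> Rn m \<and>
          (\<forall>p\<in>X. \<forall>q\<in>Rn d. \<bar>dist2 d p q - dist2 m (f p) (f q)\<bar> \<le> \<alpha> * r)))"
proof (intro exI[of _ "50180::real"] conjI allI impI)
  show "(0::real) < 50180" by simp
  fix d n :: nat and \<alpha> r :: real and X :: "(nat \<Rightarrow> real) set"
  assume asm: "0 < \<alpha> \<and> \<alpha> < 1 \<and> r > 0 \<and> X \<subseteq> Rn d \<and> finite X \<and> card X = n \<and>
       (\<forall>p\<in>X. norm2 d p \<le> r) \<and> (\<lambda>i. 0) \<in> X"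
  define L where "L = max 2 (real n)"
  have L: "2 \<le> L" "real n \<le> L" by (auto simp: L_def)
  have "ln 2 \<le> ln L" using L by simp
  then have lnL: "1 / 2 \<le> ln L" using ln2_ge_two_thirds by linarith
  define \<epsilon> where "\<epsilon> = \<alpha> / 28"
  have \<epsilon>: "0 < \<epsilon>" "\<epsilon> \<le> 1" using asm by (auto simp: \<epsilon>_def)
  \<comment> \<open>The factor 64 gives
    \<open>exp (- (m * \<epsilon>\<^sup>2 / 16)) \<le> 1 / L ^ 4\<close>, which beats the
    \<open>n\<^sup>2\<close> directions and still leaves
    \<open>1 / L\<^sup>2 \<le> 1 / 4\<close>.\<close>
  define m where "m = nat \<lceil>64 * ln L / \<epsilon>\<^sup>2\<rceil>"
  have m_ge: "64 * ln L / \<epsilon>\<^sup>2 \<le> real m" unfolding m_def by (rule real_nat_ceiling_ge)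
  have "0 < 64 * ln L / \<epsilon>\<^sup>2" using \<epsilon> lnL by simp
  then have m0: "0 < m" and m_le: "real m \<le> 64 * ln L / \<epsilon>\<^sup>2 + 1" using m_ge unfolding m_def by linarith+
  have "64 * ln L \<le> real m * \<epsilon>\<^sup>2" using m_ge \<epsilon> by (simp add: pos_divide_le_eq)
  then have "exp (- (real m * \<epsilon>\<^sup>2 / 16)) \<le> exp (- (4 * ln L))" by simp
  also have "\<dots> = 1 / L ^ 4"
    using L exp_of_nat_mult[of 4 "ln L"] by (simp add: exp_minus divide_inverse)
  finally have "(real n)\<^sup>2 * exp (- (real m * \<epsilon>\<^sup>2 / 16)) \<le> L\<^sup>2 * (1 / L ^ 4)"
    using L by (intro mult_mono power_mono) auto
  also have "\<dots> = 1 / L\<^sup>2" using L by (simp add: power2_eq_square power4_eq_xxxx)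
  also have "\<dots> \<le> 1 / 2\<^sup>2" using L by (intro divide_left_mono power_mono) auto
  finally have m: "(real (card X))\<^sup>2 * exp (- (real m * \<epsilon>\<^sup>2 / 16)) \<le> 1 / 4" using asm by simp
  have "X \<noteq> {}" using asm by blast
  then obtain f where f: "f \<in> Rn d \<rightarrow> Rn (Suc m)"
    "\<forall>p\<in>X. \<forall>q\<in>Rn d. \<bar>dist2 d p q - dist2 (Suc m) (f p) (f q)\<bar> \<le> 28 * \<epsilon> * r"
    using exists_terminal_embedding[OF _ _ _ _ \<epsilon> m0 m, of d r] asm by blast
  \<comment> \<open>The ceiling and the extra coordinate add at most 2, absorbed by
    \<open>4 * ln L / \<alpha>\<^sup>2\<close>; thus
    \<open>50180 = 64 * 28\<^sup>2 + 4\<close>.\<close>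
  have "\<alpha>\<^sup>2 \<le> 1" using asm by (simp add: power_le_one)
  then have "2 * \<alpha>\<^sup>2 \<le> 4 * ln L" using lnL by linarith
  then have "2 \<le> 4 * ln L / \<alpha>\<^sup>2" using asm by (simp add: pos_le_divide_eq)
  moreover have "64 * ln L / \<epsilon>\<^sup>2 = 50176 * ln L / \<alpha>\<^sup>2"
    by (simp add: \<epsilon>_def power_divide)
  ultimately have "real (Suc m) \<le> 50180 * (1 / \<alpha>\<^sup>2) * ln L"
    using m_le by simp
  then show "\<exists>(m::nat) (f::(nat \<Rightarrow> real) \<Rightarrow> (nat \<Rightarrow> real)).
          real m \<le> 50180 * (1 / \<alpha>\<^sup>2) * ln (max 2 (real n)) \<and>
          f \<in> Rn d \<rightarrow> Rn m \<and>
          (\<forall>p\<in>X. \<forall>q\<in>Rn d. \<bar>dist2 d p q - dist2 m (f p) (f q)\<bar> \<le> \<alpha> * r)"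
    using f by (intro exI[of _ "Suc m"] exI[of _ f]) (auto simp: L_def \<epsilon>_def)
qed

end
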